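(* Let $D_{SG}$ be the Dirac operator of the spectral triple of the Sierpinski gasket defined in the context, and for $\mathrm{Re}(z)>\log 3/\log 2$ let $\zeta_{SG}(z):=\mathrm{tr}(|D_{SG}|^{-z})$. Then $\zeta_{SG}$ has a meromorphic continuation to all of $\mathbb{C}$, given by $$\zeta_{SG}(z)=2^{z+1}\cdot\frac{1-2^{-z}}{1-3\cdot2^{-z}}\cdot\zeta(z),\qquad z\in\mathbb{C},$$ where $\zeta$ is the Riemann zeta function, and the set of complex dimensions of the gasket, i.e. the set of poles of the meromorphic continuation of $\zeta_{SG}$, is $$\{1\}\cup\left\{\frac{\log3}{\log2}+\sqrt{-1}\cdot k\cdot\frac{2\pi}{\log2} : k\in\mathbb{Z}\right\}.$$
   Context: The Sierpinski gasket: let $SG_0\subset\mathbb{R}^2$ be the boundary (three sides) of an equilateral triangle with side length $2\pi/3$, vertices $v_1,v_2,v_3$, and horizontal bottom edge. Let $F_j(x)=(x+v_j)/2$, $j=1,2,3$. Let $SG_n$ be the union of the $3^n$ triangles $F_{j_1}\circ\cdots\circ F_{j_n}(SG_0)$, each an equilateral triangle (boundary only) of side length $2^{1-n}\pi/3$ and perimeter $2^{1-n}\pi$; number these triangles $\Delta_{n,i}$, $1\le i\le 3^n$. Then $SG$ is the closure of $\bigcup_n SG_n$. For each $n\in\mathbb{N}_0=\{0,1,2,\dots\}$ and $i\in\{1,\dots,3^n\}$ let $r_{n,i}:[-2^{-n}\pi,2^{-n}\pi]\to\Delta_{n,i}$ be the parameterization by arclength (modulo $2^{1-n}\pi$), counterclockwise,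 with $r_{n,i}(0)$ the lower right-hand corner of $\Delta_{n,i}$. Let $H_{n,i}=L^2([-2^{-n}\pi,2^{-n}\pi])$ with respect to normalized Lebesgue measure, let $\pi_{n,i}(f)$, for $f\in C(SG)$, be multiplication by $f\circ r_{n,i}$, and let $D_{n,i}$ be the self-adjoint operator on $H_{n,i}$ with $D_{n,i}\phi_k=2^n(k+\tfrac12)\phi_k$ for $k\in\mathbb{Z}$, where $\phi_k(t)=\exp(i2^nkt)$ is an orthonormal basis of $H_{n,i}$. Then $H_{SG}=\bigoplus_{n,i}H_{n,i}$, $\pi_{SG}=\bigoplus_{n,i}\pi_{n,i}$, $D_{SG}=\bigoplus_{n,i}D_{n,i}$, and the spectral triple is $(C(SG),H_{SG},D_{SG})$. *)

theory Defs
  imports "HOL-Complex_Analysis.Complex_Analysis"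
begin

text \<open>
  Elements of \<open>L\<^sup>2\<close> spaces are represented by square integrable functions, so that equality in
  the Hilbert space is equality almost everywhere. Unbounded operators are represented by their
  graphs, which are closed under this equality. The inner product is linear in the second argument.
\<close>

definition L2 :: "'a measure \<Rightarrow> ('a \<Rightarrow> complex) set" where
  "L2 M = {f \<in> borel_measurable M. integrable M (\<lambda>x. (cmod (f x))\<^sup>2)}"

definition L2_inner :: "'a measure \<Rightarrow> ('a \<Rightarrow> complex) \<Rightarrow> ('a \<Rightarrow> complex) \<Rightarrow> complex" where
  "L2_inner M f g = (\<integral>x. cnj (f x) * g x \<partial>M)"


section \<open>The Dirac operator of the Sierpinski gasket\<close>

text \<open>
  The pair \<open>(n, i)\<close> stands for the triangle \<open>\<Delta>\<^bsub>n,i\<^esub>\<close>. Neither \<open>H\<^bsub>n,i\<^esub>\<close> nor \<open>D\<^bsub>n,i\<^esub>\<close> depends on \<open>i\<close>.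
\<close>

definition triangles :: "(nat \<times> nat) set" where
  "triangles = (SIGMA n:UNIV. {1..3 ^ n})"

definition arc_measure :: "nat \<Rightarrow> real measure" where
  "arc_measure n = uniform_measure lborel {- (pi / 2 ^ n)..pi / 2 ^ n}"

definition fourier :: "nat \<Rightarrow> int \<Rightarrow> real \<Rightarrow> complex" where
  "fourier n k t = exp (\<i> * 2 ^ n * of_int k * of_real t)"

definition dirac_eigenvalue :: "nat \<Rightarrow> int \<Rightarrow> real" where
  "dirac_eigenvalue n k = 2 ^ n * (of_int k + 1 / 2)"

text \<open>
  The operator \<open>D\<^bsub>n,i\<^esub>\<close> with its maximal domain: the condition says that \<open>\<langle>\<phi>\<^sub>k, g\<rangle> = \<langle>D \<phi>\<^sub>k, f\<rangle>\<close> for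
  all \<open>k\<close>, i.e. the operator is the adjoint of its restriction to the span of the \<open>\<phi>\<^sub>k\<close>. This is
  the only self-adjoint operator with the prescribed values on the orthonormal basis \<open>\<phi>\<^sub>k\<close>.
\<close>

definition dirac_triangle :: "nat \<Rightarrow> ((real \<Rightarrow> complex) \<times> (real \<Rightarrow> complex)) set" where
  "dirac_triangle n =
     {(f, g). f \<in> L2 (arc_measure n) \<and> g \<in> L2 (arc_measure n) \<and>
        (\<forall>k. L2_inner (arc_measure n) (fourier n k) g =
              of_real (dirac_eigenvalue n k) * L2_inner (arc_measure n) (fourier n k) f)}"

text \<open>
  Vectors of the direct sum are square summable families indexed by \<open>triangles\<close>; their values at
  other indices are irrelevant.
\<close>

type_synonym vec = "nat \<times> nat \<Rightarrow> real \<Rightarrow> complex"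

definition H_SG :: "vec set" where
  "H_SG = {u. (\<forall>(n, i)\<in>triangles. u (n, i) \<in> L2 (arc_measure n)) \<and>
              (\<lambda>(n, i). \<integral>t. (cmod (u (n, i) t))\<^sup>2 \<partial>arc_measure n) summable_on triangles}"

definition inner_SG :: "vec \<Rightarrow> vec \<Rightarrow> complex" where
  "inner_SG u v = (\<Sum>\<^sub>\<infinity>(n, i)\<in>triangles. L2_inner (arc_measure n) (u (n, i)) (v (n, i)))"

definition norm_SG :: "vec \<Rightarrow> real" where
  "norm_SG u = sqrt (Re (inner_SG u u))"

definition dirac_SG :: "(vec \<times> vec) set" where
  "dirac_SG = {(u, v). u \<in> H_SG \<and> v \<in> H_SG \<and>
                 (\<forall>(n, i)\<in>triangles. (u (n, i), v (n, i)) \<in> dirac_triangle n)}"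


section \<open>Functional calculus and trace\<close>

text \<open>
  \<open>h(A)\<close> for a self-adjoint operator \<open>A\<close> whose eigenvectors span a dense subspace, with maximal
  domain: the condition says that on the eigenspace of each eigenvalue \<open>c\<close> the component of
  \<open>h(A) u\<close> is \<open>h c\<close> times that of \<open>u\<close>.
\<close>

definition fun_calc :: "(real \<Rightarrow> complex) \<Rightarrow> (vec \<times> vec) set \<Rightarrow> (vec \<times> vec) set" where
  "fun_calc h A =
     {(u, v). u \<in> H_SG \<and> v \<in> H_SG \<and>
        (\<forall>c e. (e, \<lambda>p t. of_real c * e p t) \<in> A \<longrightarrow> inner_SG e v = h c * inner_SG e u)}"

definition abs_cpow :: "(vec \<times> vec) set \<Rightarrow> complex \<Rightarrow> (vec \<times> vec) set" where
  "abs_cpow A w = fun_calc (\<lambda>c. of_real \<bar>c\<bar> powr w) A"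

definition orthonormal_basis :: "vec set \<Rightarrow> bool" where
  "orthonormal_basis B \<longleftrightarrow>
     B \<subseteq> H_SG \<and>
     (\<forall>e\<in>B. \<forall>f\<in>B. inner_SG e f = (if e = f then 1 else 0)) \<and>
     (\<forall>u\<in>H_SG. \<forall>\<epsilon>>0. \<exists>S c. finite S \<and> S \<subseteq> B \<and>
        norm_SG (\<lambda>p t. u p t - (\<Sum>e\<in>S. c e * e p t)) < \<epsilon>)"

text \<open>
  \<open>T\<close> is everywhere defined and \<open>\<Sum>e\<in>B. \<langle>e, T e\<rangle>\<close> converges unconditionally to \<open>x\<close> for every
  orthonormal basis \<open>B\<close>. The function \<open>Te\<close> picks a representative of \<open>T e\<close> for each \<open>e\<close>.
\<close>

definition has_trace :: "(vec \<times> vec) set \<Rightarrow> complex \<Rightarrow> bool" where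
  "has_trace T x \<longleftrightarrow>
     Domain T = H_SG \<and>
     (\<forall>B Te. orthonormal_basis B \<longrightarrow> (\<forall>e\<in>B. (e, Te e) \<in> T) \<longrightarrow>
        ((\<lambda>e. inner_SG e (Te e)) has_sum x) B)"

definition tr :: "(vec \<times> vec) set \<Rightarrow> complex" where
  "tr T = (THE x. has_trace T x)"

definition zeta_SG :: "complex \<Rightarrow> complex" where
  "zeta_SG z = tr (abs_cpow dirac_SG (- z))"


section \<open>The Riemann zeta function\<close>

text \<open>The analytic continuation of the Dirichlet series; the value at the pole is set to 0.\<close>

definition riemann_zeta :: "complex \<Rightarrow> complex" where
  "riemann_zeta = (THE F. F holomorphic_on (- {1}) \<and> F 1 = 0 \<and>
     (\<forall>s. Re s > 1 \<longrightarrow> F s = (\<Sum>n. 1 / of_nat (Suc n) powr s)))"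


section \<open>The defining properties of the Dirac operator\<close>

lemma arc_measure_density:
  "arc_measure n =
     density lborel (\<lambda>t. ennreal (indicator {- (pi / 2 ^ n)..pi / 2 ^ n} t / (2 * (pi / 2 ^ n))))"
proof -
  have "indicator {- (pi / 2 ^ n)..pi / 2 ^ n} t / emeasure lborel {- (pi / 2 ^ n)..pi / 2 ^ n} =
        ennreal (indicator {- (pi / 2 ^ n)..pi / 2 ^ n} t / (2 * (pi / 2 ^ n)))" for t :: real
    by (cases "t \<in> {- (pi / 2 ^ n)..pi / 2 ^ n}")
       (simp_all add: ennreal_divide_numeral divide_ennreal flip: ennreal_1)
  then show ?thesis
    by (simp add: arc_measure_def uniform_measure_def)
qed

lemma sets_arc_measure [simp, measurable_cong]: "sets (arc_measure n) = sets borel"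
  by (simp add: arc_measure_def)

lemma space_arc_measure [simp]: "space (arc_measure n) = UNIV"
  by (simp add: arc_measure_def)

lemma emeasure_arc_measure_UNIV: "emeasure (arc_measure n) UNIV = 1"
  by (simp add: arc_measure_def divide_ennreal)

lemma fourier_in_L2: "fourier n k \<in> L2 (arc_measure n)"
proof -
  have "cmod (fourier n k t) = 1" for t
    by (simp add: fourier_def norm_exp_eq_Re)
  moreover have "integrable (arc_measure n) (\<lambda>_. 1 :: real)"
    by (intro finite_measure.integrable_const finite_measureI)
       (simp add: emeasure_arc_measure_UNIV)
  moreover have "continuous_on UNIV (fourier n k)"
    unfolding fourier_def by (intro continuous_intros)
  then have "fourier n k \<in> borel_measurable (arc_measure n)"
    using borel_measurable_continuous_onI measurable_cong_sets[OF sets_arc_measure refl] by blast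
  ultimately show ?thesis
    by (simp add: L2_def)
qed

lemma fourier_orthonormal:
  "L2_inner (arc_measure n) (fourier n k) (fourier n l) = (if k = l then 1 else 0)"
proof -
  define a where "a = pi / 2 ^ n"
  have a: "a > 0" by (simp add: a_def)
  have prod: "cnj (fourier n k t) * fourier n l t = fourier n (l - k) t" for t
    by (simp add: fourier_def exp_cnj algebra_simps flip: exp_add)
  have cont: "continuous_on UNIV (fourier n m)" for m
    unfolding fourier_def by (intro continuous_intros)
  have meas: "fourier n m \<in> borel_measurable lborel" for m
    using borel_measurable_continuous_onI[OF cont] by simp
  have "L2_inner (arc_measure n) (fourier n k) (fourier n l) =
        (\<integral>t. (indicator {- a..a} t / (2 * a)) *\<^sub>R fourier n (l - k) t \<partial>lborel)"
    unfolding L2_inner_def prod arc_measure_density a_def[symmetric]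
    using a by (intro integral_density meas) auto
  also have "\<dots> = (\<integral>t. (1 / (2 * a)) *\<^sub>R (indicator {- a..a} t *\<^sub>R fourier n (l - k) t) \<partial>lborel)"
    by (intro Bochner_Integration.integral_cong) (auto simp: indicator_def)
  also have "\<dots> = (1 / (2 * a)) *\<^sub>R (\<integral>t. indicator {- a..a} t *\<^sub>R fourier n (l - k) t \<partial>lborel)"
    by (rule integral_scaleR_right)
  also have "\<dots> = (if k = l then 1 else 0)"
  proof (cases "k = l")
    case True
    then show ?thesis
      using a by (simp add: fourier_def scaleR_conv_of_real complex_eq_iff)
  next
    case False
    define c where "c = \<i> * 2 ^ n * of_int (l - k)"
    have c: "c \<noteq> 0" using False by (simp add: c_def)
    have "(\<integral>t. indicator {- a..a} t *\<^sub>R fourier n (l - k) t \<partial>lborel) =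
          exp (c * of_real a) / c - exp (c * of_real (- a)) / c"
    proof (rule integral_FTC_atLeastAtMost)
      show "((\<lambda>t. exp (c * of_real t) / c) has_vector_derivative fourier n (l - k) t)
              (at t within {- a..a})" for t
      proof -
        have "((\<lambda>z. exp (c * z) / c) has_field_derivative exp (c * of_real t)) (at (of_real t))"
          using c by (auto intro!: derivative_eq_intros)
        from has_vector_derivative_real_field[OF this]
        show ?thesis by (simp add: c_def fourier_def o_def)
      qed
      show "continuous_on {- a..a} (fourier n (l - k))"
        using cont continuous_on_subset by blast
    qed (use a in auto)
    also have "exp (c * of_real a) = exp (c * of_real (- a))"
    proof -
      have "c * of_real a = c * of_real (- a) + of_real (of_int (2 * (l - k)) * pi) * \<i>"
        by (simp add: c_def a_def field_simps)
      then show ?thesis unfolding exp_eq by blast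
    qed
    finally show ?thesis using False by simp
  qed
  finally show ?thesis .
qed

lemma dirac_triangle_fourier:
  "(fourier n k, \<lambda>t. of_real (dirac_eigenvalue n k) * fourier n k t) \<in> dirac_triangle n"
proof -
  let ?c = "complex_of_real (dirac_eigenvalue n k)"
  have "(\<lambda>t. ?c * fourier n k t) \<in> L2 (arc_measure n)"
    using fourier_in_L2[of n k] by (auto simp: L2_def norm_mult power_mult_distrib)
  moreover have "L2_inner (arc_measure n) (fourier n l) (\<lambda>t. ?c * fourier n k t) =
      ?c * L2_inner (arc_measure n) (fourier n l) (fourier n k)" for l
    unfolding L2_inner_def by (subst integral_mult_right_zero[symmetric]) (simp add: mult_ac)
  ultimately show ?thesis
    using fourier_in_L2[of n k] by (auto simp: dirac_triangle_def fourier_orthonormal)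
qed

end

theory Submission
  imports Defs "HOL-Real_Asymp.Real_Asymp"
begin

text \<open>
  The trigonometric functions on the triangles form an orthonormal basis of \<open>H_SG\<close> consisting of
  eigenvectors of the Dirac operator, with eigenvalues \<open>2\<^sup>n (k + 1/2)\<close>, each \<open>3\<^sup>n\<close>
  times; completeness comes from the Weierstrass approximation theorem on the circle.
  For \<open>Re z > log 3 / log 2\<close> the sum of \<open>\<bar>\<lambda>\<bar>\<close> to the power \<open>- z\<close> over all eigenvalues
  \<open>\<lambda>\<close> converges absolutely, so by Parseval and Fubini it is the trace with respect to every
  orthonormal basis. It factors into the geometric series \<open>\<Sum>n. (3 \<cdot> 2\<^sup>-\<^sup>z)\<^sup>n\<close> and a sum over
  half integers, which is \<open>2\<^sup>z\<close> times the sum over odd numbers and hence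
  \<open>2 \<cdot> 2\<^sup>z (1 - 2\<^sup>-\<^sup>z) \<zeta>(z)\<close>. No pole of the geometric series is cancelled, because
  \<open>(1 - 2\<^sup>-\<^sup>z) \<zeta>(z)\<close> is a sum over odd numbers in which the first term dominates when
  \<open>Re z > 3/2\<close>.
\<close>

section \<open>Analytic continuation of the Riemann zeta function\<close>

text \<open>Two features of the definitions shape the work. \<open>has_trace\<close> concerns an
  everywhere defined operator and all orthonormal bases at once, so a function h of the Dirac
  operator must be shown to act on every vector, by exhibiting a square integrable function on each
  triangle; absolute summability of h over the eigenvalues provides it as a uniformly convergent
  Fourier series. And \<open>riemann_zeta\<close> is a definite description, so a function with the
  defining properties must be constructed on the whole plane. What is continued is the entire
  function G(s) = (s - 1) zeta(s): its recursion is free of poles and also yields G(1) = 1, which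
  makes z = 1 a genuine pole. The bound 3/2 is chosen because the sum of (2m + 1)^(-3/2) over m >= 1
  is below 1 by comparison with the telescoping differences of 1/sqrt(2m + 1). For the full zeta
  series near 3/2 the terms after the first exceed 1 in total, so removing the even terms is what
  lets the first term dominate.\<close>

lemma holomorphic_on_suminf:
  fixes f :: "nat \<Rightarrow> complex \<Rightarrow> complex"
  assumes "open S" and holo: "\<And>n. f n holomorphic_on S"
    and bnd: "\<And>z. z \<in> S \<Longrightarrow>
      \<exists>d M. d > 0 \<and> cball z d \<subseteq> S \<and> summable M \<and> (\<forall>n. \<forall>w\<in>cball z d. cmod (f n w) \<le> M n)"
  shows "(\<lambda>z. \<Sum>n. f n z) holomorphic_on S"
proof (rule holomorphic_uniform_sequence[OF \<open>open S\<close>, where f = "\<lambda>N z. \<Sum>n<N. f n z"])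
  show "(\<lambda>z. \<Sum>n<N. f n z) holomorphic_on S" for N
    by (intro holomorphic_intros holo)
  fix z assume "z \<in> S"
  from bnd[OF this] obtain d M where d: "d > 0" "cball z d \<subseteq> S" "summable M"
    and M: "\<And>n w. w \<in> cball z d \<Longrightarrow> cmod (f n w) \<le> M n" by blast
  have "uniform_limit (cball z d) (\<lambda>N z. \<Sum>n<N. f n z) (\<lambda>z. \<Sum>n. f n z) sequentially"
    by (rule Weierstrass_m_test) (use M d in auto)
  with d show "\<exists>d>0. cball z d \<subseteq> S \<and>
      uniform_limit (cball z d) (\<lambda>N z. \<Sum>n<N. f n z) (\<lambda>z. \<Sum>n. f n z) sequentially"
    by blast
qed

lemma norm_Suc_powr: "cmod (of_nat (Suc n) powr s) = real (Suc n) powr Re s"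
  by (subst norm_powr_real_powr) (auto simp del: of_nat_Suc)

lemma summable_Suc_powr: "a < -1 \<Longrightarrow> summable (\<lambda>n. real (Suc n) powr a)"
  using summable_real_powr_iff[of a] summable_Suc_iff[of "\<lambda>n. real n powr a"] by simp

lemma dirichlet_zeta_sums:
  assumes "Re s > 1"
  shows "(\<lambda>n. of_nat (Suc n) powr (- s)) sums (\<Sum>n. 1 / of_nat (Suc n) powr s :: complex)"
proof -
  have "summable (\<lambda>n. of_nat (Suc n) powr (- s) :: complex)"
    by (rule summable_norm_cancel) (use assms in \<open>simp only: norm_Suc_powr, simp add: summable_Suc_powr del: of_nat_Suc\<close>)
  then show ?thesis
    by (simp add: powr_minus field_simps summable_sums del: of_nat_Suc)
qed

section \<open>Taylor expansion of powers and continuation by half planes\<close>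

lemma gbinomial_Suc_rec: "of_nat (Suc k) * (a gchoose Suc k) = (a - of_nat k) * (a gchoose k)"
  for a :: "'a::field_char_0"
  using gbinomial_mult_1[of a k] by (simp add: algebra_simps)

text \<open>The remainder at n + 2 of the Taylor polynomial of degree m of x powr (1 - s) about n +
  1. The shift keeps the base point away from 0, and since the increment is 1 no powers of it
  appear.\<close>

definition powr_rem :: "nat \<Rightarrow> nat \<Rightarrow> complex \<Rightarrow> complex" where
  "powr_rem m n s = of_nat (Suc (Suc n)) powr (1 - s) -
     (\<Sum>i\<le>m. ((1 - s) gchoose i) * of_nat (Suc n) powr (1 - s - of_nat i))"

text \<open>The hypothesis makes the exponent in the derivative of order m + 1 negative in real
  part, so that derivative is largest at the left end of the segment. With \<open>Suc m\<close> for
  m, the resulting power of n + 1 is summable exactly when Re s > - m, which is the half plane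
  reached in the induction step below.\<close>

lemma powr_rem_bound:
  assumes "Re s > - real m"
  shows "cmod (powr_rem m n s) \<le>
    real (Suc m) * cmod ((1 - s) gchoose Suc m) * real (Suc n) powr (- Re s - real m)"
proof -
  define a where "a = 1 - s"
  define f where "f i x = fact i * (a gchoose i) * x powr (a - of_nat i)" for i x
  define S where "S = closed_segment (complex_of_real (Suc n)) (complex_of_real (Suc (Suc n)))"
  have S: "\<exists>t. x = of_real t \<and> t \<ge> Suc n" if "x \<in> S" for x
    using that unfolding S_def closed_segment_of_real by (auto simp: closed_segment_eq_real_ivl)
  have "cmod (f 0 (of_real (Suc (Suc n))) - (\<Sum>i\<le>m. f i (of_real (Suc n)) *
     (of_real (Suc (Suc n)) - of_real (Suc n)) ^ i / fact i))
     \<le> (fact (Suc m) * cmod (a gchoose Suc m) * real (Suc n) powr (Re a - Suc m)) *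
       cmod (of_real (Suc (Suc n)) - of_real (Suc n)) ^ Suc m / fact m"
  proof (rule complex_Taylor[of S])
    show "convex S" "complex_of_real (Suc n) \<in> S" "complex_of_real (Suc (Suc n)) \<in> S"
      by (auto simp: S_def)
    fix x assume x: "x \<in> S"
    then obtain t where t: "x = of_real t" "t \<ge> Suc n" using S by blast
    \<comment> \<open>The segment lies to the right of 0, hence off the branch cut of
      \<open>powr\<close>.\<close>
    then have "x \<notin> \<real>\<^sub>\<le>\<^sub>0" by auto
    then have *: "((\<lambda>x. x powr (a - of_nat i)) has_field_derivative
        (a - of_nat i) * x powr (a - of_nat i - 1)) (at x within S)" for i
      by (rule has_field_derivative_at_within[OF has_field_derivative_powr])
    show "(f i has_field_derivative f (Suc i) x) (at x within S)" for i
    proof -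
      have "f (Suc i) x = fact i * (of_nat (Suc i) * (a gchoose Suc i)) * x powr (a - of_nat i - 1)"
        by (simp add: f_def algebra_simps)
      also have "\<dots> = fact i * (a gchoose i) * ((a - of_nat i) * x powr (a - of_nat i - 1))"
        by (subst gbinomial_Suc_rec) (simp add: algebra_simps)
      finally show ?thesis
        unfolding f_def[of i, abs_def] using DERIV_cmult[OF *[of i]] by simp
    qed
    have "cmod (x powr (a - of_nat (Suc m))) = t powr (Re a - Suc m)"
      using t by (subst norm_powr_real_powr) auto
    also have "\<dots> \<le> real (Suc n) powr (Re a - Suc m)"
      by (rule powr_mono2') (use t assms in \<open>auto simp: a_def\<close>)
    finally show "cmod (f (Suc m) x) \<le>
        fact (Suc m) * cmod (a gchoose Suc m) * real (Suc n) powr (Re a - Suc m)"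
      unfolding f_def norm_mult norm_fact by (intro mult_left_mono) auto
  qed
  moreover have "(of_real (Suc (Suc n)) - of_real (Suc n) :: complex) = 1" by simp
  moreover have "fact (Suc m) / fact m = (real (Suc m))" by simp
  moreover have "Re a - Suc m = - Re s - m" by (simp add: a_def)
  moreover have "fact (Suc m) * c * d * 1 ^ Suc m / fact m = fact (Suc m) / fact m * c * d" for c d :: real
    by simp
  ultimately show ?thesis
    by (simp only: norm_one) (simp add: f_def powr_rem_def a_def del: of_nat_Suc)
qed

text \<open>The term i = 0 of the expansion telescopes to -1. The term i + 1 is a multiple of the
  Dirichlet series at s + i, and (1 - s choose i + 1) contains the factor 1 - s - i. This factor
  cancels the pole of zeta at s + i = 1 and turns the series into - G(s + i), which is why G rather
  than zeta is the unknown. The part with i = 0 is G(s) itself.\<close>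

lemma powr_rem_sums:
  assumes s: "Re s > 1"
    and G: "\<And>s. Re s > 1 \<Longrightarrow> G s = (s - 1) * (\<Sum>n. 1 / of_nat (Suc n) powr s)"
  shows "(\<lambda>n. powr_rem (Suc m) n s) sums
    (G s - 1 + (\<Sum>i=1..m. ((1 - s) gchoose i) / of_nat (Suc i) * G (s + of_nat i)))"
proof -
  define D where "D s = (\<Sum>n. 1 / of_nat (Suc n) powr s :: complex)" for s
  have "(\<lambda>n. of_nat (Suc n) powr (1 - s)) \<longlonglongrightarrow> (0 :: complex)"
  proof (rule tendsto_norm_zero_cancel)
    have "(\<lambda>n. real n powr (1 - Re s)) \<longlonglongrightarrow> 0"
      by (rule tendsto_neg_powr) (use s in \<open>auto simp: filterlim_real_sequentially\<close>)
    then have "(\<lambda>n. real (Suc n) powr (1 - Re s)) \<longlonglongrightarrow> 0"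
      by (rule LIMSEQ_Suc)
    then show "(\<lambda>n. cmod (of_nat (Suc n) powr (1 - s))) \<longlonglongrightarrow> 0"
      by (simp only: norm_Suc_powr) simp
  qed
  from telescope_sums[OF this]
  have 1: "(\<lambda>n. of_nat (Suc (Suc n)) powr (1 - s) - of_nat (Suc n) powr (1 - s)) sums (0 - 1 :: complex)"
    by simp
  have "(\<lambda>n. ((1 - s) gchoose Suc i) * of_nat (Suc n) powr (1 - s - of_nat (Suc i))) sums
      (- (((1 - s) gchoose i) / of_nat (Suc i) * G (s + of_nat i)))" for i
  proof -
    have "(\<lambda>n. ((1 - s) gchoose Suc i) * of_nat (Suc n) powr (- (s + of_nat i))) sums
       (((1 - s) gchoose Suc i) * D (s + of_nat i))"
      unfolding D_def by (intro sums_mult dirichlet_zeta_sums) (use s in auto)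
    moreover have "((1 - s) gchoose Suc i) = ((1 - s - of_nat i) * ((1 - s) gchoose i)) / of_nat (Suc i)"
      by (subst gbinomial_Suc_rec[symmetric]) (simp del: of_nat_Suc)
    then have "((1 - s) gchoose Suc i) * D (s + of_nat i) =
        - (((1 - s) gchoose i) / of_nat (Suc i) * ((s + of_nat i - 1) * D (s + of_nat i)))"
      by (simp only: minus_divide_left mult.commute mult.assoc times_divide_eq_left times_divide_eq_right)
         (simp add: algebra_simps del: of_nat_Suc)
    moreover have "(s + of_nat i - 1) * D (s + of_nat i) = G (s + of_nat i)"
      using G[of "s + of_nat i"] s by (simp add: D_def)
    ultimately show ?thesis by simp
  qed
  then have 2: "(\<lambda>n. \<Sum>i\<le>m. ((1 - s) gchoose Suc i) * of_nat (Suc n) powr (1 - s - of_nat (Suc i))) sums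
      (\<Sum>i\<le>m. - (((1 - s) gchoose i) / of_nat (Suc i) * G (s + of_nat i)))"
    by (intro sums_sum) auto
  have "(\<lambda>n. powr_rem (Suc m) n s) sums
      (0 - 1 - (\<Sum>i\<le>m. - (((1 - s) gchoose i) / of_nat (Suc i) * G (s + of_nat i))))"
    using sums_diff[OF 1 2]
    unfolding powr_rem_def sum.atMost_Suc_shift by (simp add: algebra_simps del: of_nat_Suc)
  moreover have "{..m} = insert 0 {1..m}" by auto
  ultimately show ?thesis by (simp add: sum_negf algebra_simps)
qed

text \<open>
  With \<open>a = 1 - s\<close>, expanding \<open>(n + 1)\<^sup>a - n\<^sup>a\<close> in powers of \<open>n\<close> and summing over \<open>n\<close> expresses
  \<open>(s - 1) \<zeta>(s)\<close> through values further to the right and an error term that converges on a larger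
  half plane.
\<close>

lemma zeta_continuation_half_plane:
  "\<exists>G. G holomorphic_on {s. Re s > 1 - real m} \<and>
     (\<forall>s. Re s > 1 \<longrightarrow> G s = (s - 1) * (\<Sum>n. 1 / of_nat (Suc n) powr s)) \<and> (m > 0 \<longrightarrow> G 1 = 1)"
proof (induction m)
  case 0
  have "(\<lambda>s. \<Sum>n. 1 / of_nat (Suc n) powr s :: complex) holomorphic_on {s. Re s > 1}"
  proof (rule holomorphic_on_suminf)
    show "open {s. Re s > 1}" by (rule open_halfspace_Re_gt)
    show "(\<lambda>s. 1 / of_nat (Suc n) powr s :: complex) holomorphic_on {s. Re s > 1}" for n
      by (intro holomorphic_intros) (auto simp del: of_nat_Suc)
    fix z :: complex assume "z \<in> {s. Re s > 1}"
    then have z: "Re z > 1" by simp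
    define d where "d = (Re z - 1) / 2"
    have Re: "Re w \<ge> Re z - d" if "w \<in> cball z d" for w
      using that abs_Re_le_cmod[of "z - w"] by (auto simp: dist_norm)
    have "cmod (1 / of_nat (Suc n) powr w) \<le> real (Suc n) powr (- (Re z - d))" if "w \<in> cball z d" for n w
    proof -
      have "cmod (1 / of_nat (Suc n) powr w) = real (Suc n) powr (- Re w)"
        by (simp add: norm_divide norm_Suc_powr powr_minus field_simps del: of_nat_Suc)
      also have "\<dots> \<le> real (Suc n) powr (- (Re z - d))"
        using Re[OF that] by (intro powr_mono) auto
      finally show ?thesis .
    qed
    moreover have "summable (\<lambda>n. real (Suc n) powr (- (Re z - d)))"
      by (rule summable_Suc_powr) (use z in \<open>auto simp: d_def field_simps\<close>)
    moreover have "d > 0" "cball z d \<subseteq> {s. Re s > 1}"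
      using z Re by (force simp: d_def field_simps)+
    ultimately show "\<exists>d M. d > 0 \<and> cball z d \<subseteq> {s. Re s > 1} \<and> summable M \<and>
        (\<forall>n. \<forall>w\<in>cball z d. cmod (1 / of_nat (Suc n) powr w) \<le> M n)" by blast
  qed
  then show ?case
    by (intro exI[of _ "\<lambda>s. (s - 1) * (\<Sum>n. 1 / of_nat (Suc n) powr s)"]) (auto intro!: holomorphic_intros)
next
  case (Suc m)
  then obtain G where G: "G holomorphic_on {s. Re s > 1 - real m}"
    and G_eq: "\<And>s. Re s > 1 \<Longrightarrow> G s = (s - 1) * (\<Sum>n. 1 / of_nat (Suc n) powr s)" by blast
  let ?S = "{s. Re s > - real m}"
  have "(\<lambda>s. \<Sum>n. powr_rem (Suc m) n s) holomorphic_on ?S"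
  proof (rule holomorphic_on_suminf)
    show "open ?S" by (rule open_halfspace_Re_gt)
    show "powr_rem (Suc m) n holomorphic_on ?S" for n
      unfolding powr_rem_def gbinomial_prod_rev
      by (intro holomorphic_intros) (auto simp del: of_nat_Suc)
    fix z :: complex assume "z \<in> ?S"
    then have z: "Re z > - real m" by simp
    define d where "d = (Re z + m) / 2"
    have Re: "Re w \<ge> Re z - d" if "w \<in> cball z d" for w
      using that abs_Re_le_cmod[of "z - w"] by (auto simp: dist_norm)
    have d: "d > 0" "cball z d \<subseteq> ?S"
      using z Re by (force simp: d_def field_simps)+
    define C where "C w = real (Suc (Suc m)) * cmod ((1 - w) gchoose Suc (Suc m))" for w
    have "continuous_on (cball z d) C"
      unfolding C_def gbinomial_prod_rev by (intro continuous_intros) (simp del: of_nat_Suc fact_Suc)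
    then have "bounded (C ` cball z d)"
      by (intro compact_imp_bounded compact_continuous_image) auto
    then obtain K where K: "\<And>w. w \<in> cball z d \<Longrightarrow> C w \<le> K" "K > 0"
      unfolding bounded_pos by (force dest: abs_le_D1)
    have "cmod (powr_rem (Suc m) n w) \<le> K * real (Suc n) powr (- (Re z - d) - Suc m)"
      if "w \<in> cball z d" for n w
    proof -
      have "cmod (powr_rem (Suc m) n w) \<le> C w * real (Suc n) powr (- Re w - Suc m)"
        unfolding C_def by (rule powr_rem_bound) (use that d in auto)
      also have "\<dots> \<le> K * real (Suc n) powr (- (Re z - d) - Suc m)"
        using Re[OF that] K that by (intro mult_mono powr_mono) auto
      finally show ?thesis .
    qed
    moreover have "summable (\<lambda>n. K * real (Suc n) powr (- (Re z - d) - Suc m))"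
      by (intro summable_mult summable_Suc_powr) (use z in \<open>auto simp: d_def field_simps\<close>)
    ultimately show "\<exists>d M. d > 0 \<and> cball z d \<subseteq> ?S \<and> summable M \<and>
        (\<forall>n. \<forall>w\<in>cball z d. cmod (powr_rem (Suc m) n w) \<le> M n)" using d by blast
  qed
  moreover have "(\<lambda>s. G (s + of_nat i)) holomorphic_on ?S" if "i \<in> {1..m}" for i
    by (rule holomorphic_on_compose_gen[OF _ G, unfolded o_def])
       (use that in \<open>auto intro!: holomorphic_intros\<close>)
  \<comment> \<open>This is \<open>powr_rem_sums\<close> solved for G(s). All shifts have i >= 1, so
    for Re s > - m they stay in the half plane where G is already holomorphic.\<close>
  ultimately have "(\<lambda>s. 1 + (\<Sum>n. powr_rem (Suc m) n s) -
      (\<Sum>i=1..m. ((1 - s) gchoose i) / of_nat (Suc i) * G (s + of_nat i))) holomorphic_on ?S"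
    (is "?G holomorphic_on _")
    unfolding gbinomial_prod_rev by (intro holomorphic_intros) (auto simp del: of_nat_Suc)
  moreover have "?G s = G s" if "Re s > 1" for s
    using sums_unique[OF powr_rem_sums[OF that G_eq, of m]] by (simp add: algebra_simps)
  \<comment> \<open>At s = 1 the exponent 1 - s is 0: every binomial with i > 0 vanishes and each
    remainder is 1 - 1 = 0, so only the leading 1 survives. This is the residue of zeta at
    1.\<close>
  moreover have "?G 1 = 1"
  proof -
    have "(0 gchoose i) = (if i = 0 then 1 else 0 :: complex)" for i
      by (cases i) auto
    then show ?thesis by (simp add: powr_rem_def sum.atMost_shift if_distrib[of "\<lambda>x. x * _"] del: of_nat_Suc)
  qed
  ultimately show ?case
    using G_eq by (intro exI[of _ ?G]) simp
qed

lemma zeta_continuation: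
  obtains G where "G holomorphic_on UNIV" "G 1 = 1"
    "\<And>s. Re s > 1 \<Longrightarrow> G s = (s - 1) * (\<Sum>n. 1 / of_nat (Suc n) powr s)"
proof -
  have "\<exists>G. \<forall>m. G m holomorphic_on {s. Re s > 1 - real m} \<and>
     (\<forall>s. Re s > 1 \<longrightarrow> G m s = (s - 1) * (\<Sum>n. 1 / of_nat (Suc n) powr s)) \<and> (m > 0 \<longrightarrow> G m 1 = 1)"
    using zeta_continuation_half_plane by (intro choice) blast
  then obtain G where G: "\<And>m. G m holomorphic_on {s. Re s > 1 - real m}"
    "\<And>m s. Re s > 1 \<Longrightarrow> G m s = (s - 1) * (\<Sum>n. 1 / of_nat (Suc n) powr s)" "\<And>m. m > 0 \<Longrightarrow> G m 1 = 1"
    by blast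
  have agree: "G m s = G k s" if "k \<le> m" "Re s > 1 - real k" for m k s
  proof (rule analytic_continuation_open[of "{s. Re s > 1}" "{s. Re s > 1 - real k}" "G m" "G k"])
    show "open {s. Re s > 1}" "open {s. Re s > 1 - real k}" by (rule open_halfspace_Re_gt)+
    have "2 \<in> {s. Re s > 1}" by simp
    then show "{s. Re s > 1} \<noteq> {}" by blast
    show "connected {s. Re s > 1 - real k}"
      by (intro convex_connected convex_halfspace_Re_gt)
    show "G m holomorphic_on {s. Re s > 1 - real k}"
      by (rule holomorphic_on_subset[OF G(1)[of m]]) (use that in auto)
  qed (use G that in auto)
  \<comment> \<open>The index depends on s and satisfies Re s > 1 - m strictly. By
    \<open>agree\<close> the choice does not matter, so on each half plane H coincides with a single
    holomorphic function.\<close>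
  define H where "H s = G (nat \<lceil>2 - Re s\<rceil>) s" for s
  have nat: "Re s > 1 - real (nat \<lceil>2 - Re s\<rceil>)" for s by linarith
  have H: "H s = G m s" if "Re s > 1 - real m" for m s
    unfolding H_def using agree[of m "nat \<lceil>2 - Re s\<rceil>" s] agree[of "nat \<lceil>2 - Re s\<rceil>" m s] that nat[of s]
    by (metis nle_le)
  show ?thesis
  proof
    have "H holomorphic_on {s. Re s > 1 - real m}" for m
      using G(1)[of m] by (rule holomorphic_transform) (simp add: H)
    then have "H holomorphic_on (\<Union>m. {s. Re s > 1 - real m})"
      by (intro holomorphic_on_UN_open open_halfspace_Re_gt)
    moreover have "(\<Union>m. {s. Re s > 1 - real m}) = UNIV" using nat by blast
    ultimately show "H holomorphic_on UNIV" by simp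
    show "H 1 = 1" using H[of 1 1] G(3)[of 1] by simp
    show "H s = (s - 1) * (\<Sum>n. 1 / of_nat (Suc n) powr s)" if "Re s > 1" for s
      using H[of 0 s] G(2)[of s 0] that by simp
  qed
qed

section \<open>The series over the odd numbers and non-vanishing\<close>

lemma odd_dirichlet_sums:
  assumes "Re s > 1"
  shows "(\<lambda>m. of_nat (2 * m + 1) powr (- s)) sums
    ((1 - 2 powr (- s)) * (\<Sum>n. 1 / of_nat (Suc n) powr s :: complex))"
proof -
  define D where "D = (\<Sum>n. 1 / of_nat (Suc n) powr s :: complex)"
  have D: "(\<lambda>n. of_nat (Suc n) powr (- s)) sums D"
    unfolding D_def by (rule dirichlet_zeta_sums) fact
  have even: "of_nat (2 * m + 2) powr (- s) = 2 powr (- s) * of_nat (Suc m) powr (- s)" for m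
    using powr_times_real[of 2 "of_nat (Suc m)" "- s"] by (simp add: algebra_simps)
  \<comment> \<open>Consecutive terms are grouped in pairs, one odd and one even number; the even
    ones together give 2 powr (- s) times the whole series.\<close>
  have "(\<lambda>m. \<Sum>n\<in>{m*2..<m*2+2}. of_nat (Suc n) powr (- s)) sums D"
    by (rule sums_group[OF D]) auto
  moreover have "(\<Sum>n\<in>{m*2..<m*2+2}. of_nat (Suc n) powr (- s)) =
      of_nat (2 * m + 1) powr (- s) + 2 powr (- s) * of_nat (Suc m) powr (- s)" for m
  proof -
    have "{m*2..<m*2+2} = {2*m, Suc (2*m)}" by auto
    then show ?thesis using even[of m] by simp
  qed
  ultimately have "(\<lambda>m. of_nat (2 * m + 1) powr (- s) + 2 powr (- s) * of_nat (Suc m) powr (- s)) sums D"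
    by simp
  from sums_diff[OF this sums_mult[OF D, of "2 powr (- s)"]] show ?thesis
    by (simp add: D_def algebra_simps)
qed

text \<open>If the series vanished, so would the sum over the odd numbers. Its first term is 1, so
  the remaining terms would add up to -1, although their moduli add up to less than 1.\<close>

lemma dirichlet_zeta_nonzero:
  assumes "Re s > 3 / 2"
  shows "(\<Sum>n. 1 / of_nat (Suc n) powr s) \<noteq> (0 :: complex)"
proof
  assume "(\<Sum>n. 1 / of_nat (Suc n) powr s) = (0 :: complex)"
  with odd_dirichlet_sums[of s] assms have "(\<lambda>m. of_nat (2 * m + 1) powr (- s)) sums (0 :: complex)"
    by simp
  then have 1: "(\<lambda>m. of_nat (2 * m + 3) powr (- s)) sums (- 1 :: complex)"
    using sums_Suc_iff[of "\<lambda>m. of_nat (2 * m + 1) powr (- s) :: complex" "- 1"]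
    by (simp add: algebra_simps)
  \<comment> \<open>Up to sign, b is an antiderivative of (2x + 1) powr (- 3/2), so its differences
    should dominate the terms; and b 0 = 1 is exactly the total allowed.\<close>
  define b where "b m = 1 / sqrt (2 * real m + 1)" for m
  have step: "real (2 * m + 3) powr (- (3/2)) < b m - b (Suc m)" for m
  proof -
    define x y where "x = sqrt (2 * real m + 1)" and "y = sqrt (2 * real m + 3)"
    have xy: "0 < x" "x < y" "y\<^sup>2 = x\<^sup>2 + 2" by (auto simp: x_def y_def)
    have "real (2 * m + 3) = y powr 2" by (auto simp: y_def powr_numeral)
    then have "real (2 * m + 3) powr (- (3/2)) = y powr (- 3)"
      by (simp only: powr_powr) simp
    also have "\<dots> = 1 / y ^ 3"
      using xy by (simp add: powr_minus powr_numeral field_simps)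
    also have "\<dots> < 1 / x - 1 / y"
    proof -
      \<comment> \<open>Since (y - x)(y + x) = 2, the wanted inequality 1/y^3 < 1/x - 1/y, cleared
        of denominators and multiplied by x + y, reads x (x + y) < 2 y^2.\<close>
      have "x * (x + y) < y * (y + y)" using xy by (intro mult_strict_mono) auto
      then have "x * (x + y) < y\<^sup>2 * ((y - x) * (y + x))"
        using xy by (simp add: power2_eq_square algebra_simps)
      then have "x < y\<^sup>2 * (y - x)" using xy
        by (simp add: mult.assoc[symmetric] add.commute)
      then have "0 < (y\<^sup>2 * (y - x) - x) / (x * y ^ 3)" using xy by simp
      also have "\<dots> = 1 / x - 1 / y - 1 / y ^ 3"
      proof -
        have "x \<noteq> 0" "y \<noteq> 0" using xy by auto
        then show ?thesis by (simp add: field_simps power3_eq_cube power2_eq_square)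
      qed
      finally show ?thesis by simp
    qed
    finally show ?thesis by (simp add: b_def x_def y_def add.commute)
  qed
  have "b \<longlonglongrightarrow> 0" unfolding b_def by real_asymp
  from telescope_sums'[OF this] have b: "(\<lambda>m. b m - b (Suc m)) sums 1" by (simp add: b_def)
  have le: "cmod (of_nat (2 * m + 3) powr (- s)) \<le> real (2 * m + 3) powr (- (3/2))" for m
  proof -
    have "cmod (of_nat (2 * m + 3) powr (- s)) = real (2 * m + 3) powr (- Re s)"
      using norm_Suc_powr[of "2 * m + 2" "- s"] by (simp add: numeral_3_eq_3)
    also have "\<dots> \<le> real (2 * m + 3) powr (- (3/2))" using assms by (intro powr_mono) auto
    finally show ?thesis .
  qed
  then have le': "cmod (of_nat (2 * m + 3) powr (- s)) \<le> b m - b (Suc m)" for m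
    using step[of m] by (meson le less_imp_le order_trans)
  have summ: "summable (\<lambda>m. cmod (of_nat (2 * m + 3) powr (- s)))"
    by (rule summable_comparison_test'[OF sums_summable[OF b], of 0]) (use le' in simp)
  have "1 = cmod (\<Sum>m. of_nat (2 * m + 3) powr (- s))"
    by (simp only: sums_unique[OF 1, symmetric] norm_minus_cancel norm_one)
  also have "\<dots> \<le> (\<Sum>m. cmod (of_nat (2 * m + 3) powr (- s)))"
    by (rule summable_norm[OF summ])
  also have "\<dots> < (\<Sum>m. b m - b (Suc m))"
  proof -
    \<comment> \<open>The strict inequality survives the limit because every term of the series of
      differences is positive.\<close>
    have "0 < (\<Sum>m. (b m - b (Suc m)) - cmod (of_nat (2 * m + 3) powr (- s)))"
      by (intro suminf_pos summable_diff sums_summable[OF b] summ)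
         (use le step in \<open>auto intro: le_less_trans\<close>)
    then show ?thesis using suminf_diff[OF sums_summable[OF b] summ] by linarith
  qed
  also have "\<dots> = 1" using b by (simp add: sums_iff)
  finally show False by simp
qed


section \<open>Poles of the closed formula\<close>

text \<open>G(s) / (s - 1) meets the description: division by zero supplies the prescribed value 0
  at s = 1. Uniqueness is the identity theorem, applicable because the punctured plane is
  connected.\<close>

lemma riemann_zeta_eq:
  obtains G where "G holomorphic_on UNIV" "G 1 = 1" "\<And>s. riemann_zeta s = G s / (s - 1)"
    "\<And>s. Re s > 1 \<Longrightarrow> riemann_zeta s = (\<Sum>n. 1 / of_nat (Suc n) powr s)"
proof -
  obtain G where G: "G holomorphic_on UNIV" "G 1 = 1"
    "\<And>s. Re s > 1 \<Longrightarrow> G s = (s - 1) * (\<Sum>n. 1 / of_nat (Suc n) powr s)"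
    using zeta_continuation by blast
  have "riemann_zeta = (\<lambda>s. G s / (s - 1))"
    unfolding riemann_zeta_def
  proof (rule the_equality)
    show "(\<lambda>s. G s / (s - 1)) holomorphic_on - {1} \<and> G 1 / (1 - 1) = 0 \<and>
      (\<forall>s. Re s > 1 \<longrightarrow> G s / (s - 1) = (\<Sum>n. 1 / of_nat (Suc n) powr s))"
      using G by (auto intro!: holomorphic_intros intro: holomorphic_on_subset)
    fix F :: "complex \<Rightarrow> complex"
    assume F: "F holomorphic_on - {1} \<and> F 1 = 0 \<and>
      (\<forall>s. Re s > 1 \<longrightarrow> F s = (\<Sum>n. 1 / of_nat (Suc n) powr s))"
    have "F s = G s / (s - 1)" if "s \<noteq> 1" for s
    proof (rule analytic_continuation_open[of "{s. Re s > 1}" "- {1}" F "\<lambda>s. G s / (s - 1)"])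
      show "open {s. Re s > 1}" by (rule open_halfspace_Re_gt)
      have "2 \<in> {s. Re s > 1}" by simp
      then show "{s. Re s > 1} \<noteq> {}" by blast
      show "connected (- {1 :: complex})"
        by (rule connected_punctured_universe) simp
      show "(\<lambda>s. G s / (s - 1)) holomorphic_on - {1}"
        using G by (auto intro!: holomorphic_intros intro: holomorphic_on_subset)
    qed (use F G that in auto)
    with F show "F = (\<lambda>s. G s / (s - 1))" by (metis (no_types, lifting) div_by_0 diff_self ext)
  qed
  with G(3) have eq: "riemann_zeta s = G s / (s - 1)" for s by metis
  show ?thesis
    by (rule that[OF G(1,2) eq]) (auto simp: eq G(3) simp del: of_nat_Suc)
qed

lemma two_powr_eq_3_iff:
  "2 powr z = 3 \<longleftrightarrow> (\<exists>k::int. z = of_real (ln 3 / ln 2) + \<i> * of_int k * of_real (2 * pi / ln 2))"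
proof -
  have "2 powr z = 3 \<longleftrightarrow> exp (z * of_real (ln 2)) = exp (of_real (ln 3))"
    unfolding exp_of_real by (simp add: powr_def Ln_of_real[of 2, simplified])
  also have "\<dots> \<longleftrightarrow> (\<exists>k::int. z * of_real (ln 2) = of_real (ln 3) + of_real (2 * of_int k * pi) * \<i>)"
    by (simp add: exp_eq)
  also have "\<dots> \<longleftrightarrow> (\<exists>k::int. z = of_real (ln 3 / ln 2) + \<i> * of_int k * of_real (2 * pi / ln 2))"
  proof (intro ex_cong1)
    fix k :: int
    have "z * L = A + of_real (2 * of_int k * pi) * \<i> \<longleftrightarrow> z = A / L + \<i> * of_int k * (2 * of_real pi / L)"
      if "L \<noteq> 0" for A L :: complex
      using that by (auto simp: field_simps)
    from this[of "of_real (ln 2)" "of_real (ln 3)"]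
    show "z * of_real (ln 2) = of_real (ln 3) + of_real (2 * of_int k * pi) * \<i> \<longleftrightarrow>
        z = of_real (ln 3 / ln 2) + \<i> * of_int k * of_real (2 * pi / ln 2)"
      by simp
  qed
  finally show ?thesis .
qed

text \<open>This is 2^3 < 3^2. It places all zeros of 1 - 3 * 2 powr (- z) in the half plane where
  \<open>dirichlet_zeta_nonzero\<close> applies.\<close>

lemma log_2_3_gt: "ln 3 / ln 2 > (3 / 2 :: real)"
proof -
  have "3 * ln 2 = ln (2 ^ 3 :: real)" by (subst ln_realpow) auto
  also have "\<dots> < ln (3 ^ 2)" by (subst ln_less_cancel_iff) auto
  also have "\<dots> = 2 * ln 3" by (subst ln_realpow) auto
  finally show ?thesis by (simp add: field_simps)
qed

text \<open>Moving the pole of zeta into the denominator writes F as a quotient N / d of entire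
  functions. The poles are then the zeros of d, whatever their order, as soon as N does not vanish
  there.\<close>

lemma zeta_SG_formula_meromorphic:
  defines "F \<equiv> \<lambda>z. 2 powr (z + 1) * ((1 - 2 powr (- z)) / (1 - 3 * 2 powr (- z))) * riemann_zeta z"
  shows "F nicely_meromorphic_on UNIV"
    and "{z. is_pole F z} =
      {1} \<union> {of_real (ln 3 / ln 2) + \<i> * of_int k * of_real (2 * pi / ln 2) | k. True}" (is "_ = ?P")
proof -
  obtain G where G: "G holomorphic_on UNIV" "G 1 = 1" "\<And>s. riemann_zeta s = G s / (s - 1)"
    "\<And>s. Re s > 1 \<Longrightarrow> riemann_zeta s = (\<Sum>n. 1 / of_nat (Suc n) powr s)"
    using riemann_zeta_eq by metis
  define N where "N z = 2 powr (z + 1) * (1 - 2 powr (- z)) * G z" for z :: complex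
  define d where "d z = (1 - 3 * 2 powr (- z)) * (z - 1)" for z :: complex
  have F: "F = (\<lambda>z. N z / d z)"
    by (simp add: F_def N_def d_def G(3) fun_eq_iff)
  have N: "N holomorphic_on UNIV" and d: "d holomorphic_on UNIV"
    unfolding N_def d_def by (intro holomorphic_intros G; simp)+
  have zero3: "1 - 3 * 2 powr (- z) = 0 \<longleftrightarrow> 2 powr z = 3" for z :: complex
    by (auto simp: powr_minus field_simps)
  have d0: "d z = 0 \<longleftrightarrow> z \<in> ?P" for z
    unfolding d_def mult_eq_0_iff zero3 two_powr_eq_3_iff by auto
  have N1: "N z \<noteq> 0" if "z \<in> ?P" for z
  proof (cases "z = 1")
    case True
    then show ?thesis using G(2) by (simp add: N_def powr_minus)
  next
    case False
    with that have "2 powr z = 3" unfolding two_powr_eq_3_iff by auto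
    moreover have "Re z = ln 3 / ln 2" using that False by auto
    then have Re: "Re z > 3 / 2" using log_2_3_gt by simp
    have "G z \<noteq> 0"
      using dirichlet_zeta_nonzero[OF Re] G(3,4)[of z] Re by auto
    ultimately show ?thesis by (simp add: N_def powr_minus)
  qed
  have mero: "F meromorphic_on UNIV"
    unfolding F using N d by (intro meromorphic_intros analytic_on_imp_meromorphic_on)
       (auto simp: analytic_on_open)
  have ev: "eventually (\<lambda>w. d w \<noteq> 0) (at z)" for z
  proof -
    \<comment> \<open>The value d 0 = 2 shows that d is not identically zero, so its zeros are
      isolated.\<close>
    have "d 0 \<noteq> 0" by (simp add: d_def)
    then show ?thesis
      using non_zero_neighbour_alt[of d UNIV z 0] d connected_UNIV by simp
  qed
  have cont: "isCont N z" "isCont d z" for z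
    using holomorphic_on_imp_continuous_on[OF N] holomorphic_on_imp_continuous_on[OF d]
    by (auto simp: continuous_on_eq_continuous_at)
  have lim: "d \<midarrow>z\<rightarrow> 0" if "z \<in> ?P" for z
    using isContD[OF cont(2), of z] d0[of z] that by metis
  have pole: "is_pole F z" if "z \<in> ?P" for z
    unfolding F by (rule is_pole_divide[OF cont(1) filterlim_atI[OF lim[OF that] ev] N1[OF that]])
  have "N analytic_on {z}" "d analytic_on {z}" for z
    using N d by (auto simp: analytic_at intro!: exI[of _ UNIV])
  then have ana: "F analytic_on {z}" if "z \<notin> ?P" for z
    unfolding F using that d0[of z] by (intro analytic_on_divide) blast+
  have "is_pole F z \<longleftrightarrow> z \<in> ?P" for z
    using pole ana by (meson analytic_at_imp_no_pole)
  then show "{z. is_pole F z} = ?P" by blast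
  show "F nicely_meromorphic_on UNIV"
    unfolding nicely_meromorphic_on_def
  proof (intro conjI ballI mero)
    fix z
    show "is_pole F z \<and> F z = 0 \<or> F \<midarrow>z\<rightarrow> F z"
    proof (cases "z \<in> ?P")
      case True
      \<comment> \<open>Division by zero makes F vanish at its poles, which is the value
        \<open>nicely_meromorphic_on\<close> demands.\<close>
      then show ?thesis using pole[OF True] d0[of z] by (simp add: F)
    next
      case False
      then show ?thesis using ana[OF False] by (metis analytic_at_imp_isCont isContD)
    qed
  qed
qed

section \<open>Square integrable functions\<close>

lemma L2_measurable [measurable_dest]: "f \<in> L2 M \<Longrightarrow> f \<in> borel_measurable M"
  by (simp add: L2_def)

lemma L2_sq_integrable: "f \<in> L2 M \<Longrightarrow> integrable M (\<lambda>x. (cmod (f x))\<^sup>2)"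
  by (simp add: L2_def)

text \<open>The price for staying with squared norms is a factor 2, harmless in closure and
  approximation arguments.\<close>

lemma norm_add_sq_le: "(cmod (a + b))\<^sup>2 \<le> 2 * (cmod a)\<^sup>2 + 2 * (cmod b)\<^sup>2"
proof -
  have "(cmod (a + b))\<^sup>2 \<le> (cmod a + cmod b)\<^sup>2"
    by (intro power_mono norm_triangle_ineq) auto
  also have "\<dots> \<le> 2 * (cmod a)\<^sup>2 + 2 * (cmod b)\<^sup>2"
    using zero_le_power2[of "cmod a - cmod b"] by (simp add: power2_sum power2_diff)
  finally show ?thesis .
qed

lemma L2_add:
  assumes "f \<in> L2 M" "g \<in> L2 M"
  shows "(\<lambda>x. f x + g x) \<in> L2 M"
proof -
  have meas: "(\<lambda>x. f x + g x) \<in> borel_measurable M"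
    by (intro borel_measurable_add L2_measurable assms)
  have "integrable M (\<lambda>x. 2 * (cmod (f x))\<^sup>2 + 2 * (cmod (g x))\<^sup>2)"
    using L2_sq_integrable[OF assms(1)] L2_sq_integrable[OF assms(2)] by simp
  then have "integrable M (\<lambda>x. (cmod (f x + g x))\<^sup>2)"
    by (rule Bochner_Integration.integrable_bound)
       (use meas in measurable, simp add: norm_add_sq_le)
  with meas show ?thesis by (simp add: L2_def)
qed

lemma L2_scale: "f \<in> L2 M \<Longrightarrow> (\<lambda>x. c * f x) \<in> L2 M"
  by (auto simp: L2_def norm_mult power_mult_distrib)

lemma L2_diff: "f \<in> L2 M \<Longrightarrow> g \<in> L2 M \<Longrightarrow> (\<lambda>x. f x - g x) \<in> L2 M"
  using L2_add[OF _ L2_scale[of g M "-1"], of f] by simp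

lemma L2_zero: "(\<lambda>x. 0) \<in> L2 M"
  by (simp add: L2_def)

lemma L2_sum: "(\<And>i. i \<in> I \<Longrightarrow> f i \<in> L2 M) \<Longrightarrow> (\<lambda>x. \<Sum>i\<in>I. f i x) \<in> L2 M"
  by (induction I rule: infinite_finite_induct) (simp_all add: L2_zero L2_add)

lemma L2_bounded:
  assumes "finite_measure M" "f \<in> borel_measurable M" "\<And>x. x \<in> space M \<Longrightarrow> cmod (f x) \<le> C"
  shows "f \<in> L2 M"
proof -
  have "integrable M (\<lambda>x. (cmod (f x))\<^sup>2)"
    by (rule finite_measure.integrable_const_bound[OF assms(1), where B = "C\<^sup>2"])
       (use assms(2,3) in \<open>simp_all add: power_mono\<close>)
  then show ?thesis using assms(2) by (simp add: L2_def)
qed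

lemma norm_mult_le_sq: "cmod (cnj a * b) \<le> ((cmod a)\<^sup>2 + (cmod b)\<^sup>2) / 2"
  using zero_le_power2[of "cmod a - cmod b"] by (simp add: norm_mult power2_diff)

lemma L2_inner_integrable:
  assumes "f \<in> L2 M" "g \<in> L2 M"
  shows "integrable M (\<lambda>x. cnj (f x) * g x)"
proof (rule Bochner_Integration.integrable_bound[of M "\<lambda>x. ((cmod (f x))\<^sup>2 + (cmod (g x))\<^sup>2) / 2"])
  show "integrable M (\<lambda>x. ((cmod (f x))\<^sup>2 + (cmod (g x))\<^sup>2) / 2)"
    using L2_sq_integrable[OF assms(1)] L2_sq_integrable[OF assms(2)] by simp
  have "continuous_on UNIV cnj" by (intro continuous_intros)
  then show "(\<lambda>x. cnj (f x) * g x) \<in> borel_measurable M"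
    by (intro borel_measurable_times L2_measurable assms
        measurable_compose[OF L2_measurable[OF assms(1)] borel_measurable_continuous_onI])
  show "AE x in M. cmod (cnj (f x) * g x) \<le> norm (((cmod (f x))\<^sup>2 + (cmod (g x))\<^sup>2) / 2)"
    using norm_mult_le_sq by auto
qed

lemma L2_norm_add_sq_le:
  assumes "f \<in> L2 M" "g \<in> L2 M"
  shows "(\<integral>x. (cmod (f x + g x))\<^sup>2 \<partial>M) \<le> 2 * (\<integral>x. (cmod (f x))\<^sup>2 \<partial>M) + 2 * (\<integral>x. (cmod (g x))\<^sup>2 \<partial>M)"
proof -
  have "(\<integral>x. (cmod (f x + g x))\<^sup>2 \<partial>M) \<le> (\<integral>x. 2 * (cmod (f x))\<^sup>2 + 2 * (cmod (g x))\<^sup>2 \<partial>M)"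
    by (intro integral_mono norm_add_sq_le)
       (use L2_sq_integrable[OF L2_add[OF assms]] L2_sq_integrable[OF assms(1)] L2_sq_integrable[OF assms(2)] in simp_all)
  also have "\<dots> = 2 * (\<integral>x. (cmod (f x))\<^sup>2 \<partial>M) + 2 * (\<integral>x. (cmod (g x))\<^sup>2 \<partial>M)"
    using L2_sq_integrable[OF assms(1)] L2_sq_integrable[OF assms(2)] by simp
  finally show ?thesis .
qed

section \<open>Density of the trigonometric polynomials\<close>

lemma finite_arc_measure: "finite_measure (arc_measure n)"
  by (rule finite_measureI) (simp add: emeasure_arc_measure_UNIV)

text \<open>Frequencies may repeat, so sums need no bookkeeping and closure under products is a
  double induction; \<open>trig_poly_sum\<close> collects the coefficients afterwards.\<close>

inductive trig_poly :: "nat \<Rightarrow> (real \<Rightarrow> complex) \<Rightarrow> bool" for n where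
  monom: "trig_poly n (\<lambda>t. c * fourier n k t)"
| add: "trig_poly n p \<Longrightarrow> trig_poly n q \<Longrightarrow> trig_poly n (\<lambda>t. p t + q t)"

lemma trig_poly_const: "trig_poly n (\<lambda>t. c)"
  using trig_poly.monom[of n c 0] by (simp add: fourier_def)

lemma trig_poly_mult:
  assumes "trig_poly n p" "trig_poly n q"
  shows "trig_poly n (\<lambda>t. p t * q t)"
  using assms(1)
proof induction
  case (monom c k)
  show ?case using assms(2)
  proof induction
    case (monom d l)
    have "(\<lambda>t. (c * d) * fourier n (k + l) t) = (\<lambda>t. c * fourier n k t * (d * fourier n l t))"
      by (simp add: fourier_def fun_eq_iff algebra_simps exp_add)
    then show ?case using trig_poly.monom[of n "c * d" "k + l"] by simp
  next
    case (add p q)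
    then show ?case using trig_poly.add by (simp add: algebra_simps)
  qed
next
  case (add p1 p2)
  then show ?case using trig_poly.add by (simp add: algebra_simps)
qed

lemma trig_poly_L2: "trig_poly n p \<Longrightarrow> p \<in> L2 (arc_measure n)"
  by (induction rule: trig_poly.induct) (simp_all add: L2_add L2_scale fourier_in_L2)

lemma trig_poly_sum:
  "trig_poly n p \<Longrightarrow> \<exists>S c. finite S \<and> p = (\<lambda>t. \<Sum>k\<in>S. c k * fourier n k t)"
proof (induction rule: trig_poly.induct)
  case (monom c k)
  show ?case by (intro exI[of _ "{k}"] exI[of _ "\<lambda>_. c"]) simp
next
  case (add p q)
  then obtain S c T d where S: "finite S" "p = (\<lambda>t. \<Sum>k\<in>S. c k * fourier n k t)"
    and T: "finite T" "q = (\<lambda>t. \<Sum>k\<in>T. d k * fourier n k t)" by blast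
  have "(\<Sum>k\<in>S. c k * fourier n k t) = (\<Sum>k\<in>S \<union> T. (if k \<in> S then c k else 0) * fourier n k t)"
       "(\<Sum>k\<in>T. d k * fourier n k t) = (\<Sum>k\<in>S \<union> T. (if k \<in> T then d k else 0) * fourier n k t)" for t
    using S T by (auto intro!: sum.mono_neutral_cong_left)
  then have "(\<lambda>t. p t + q t) =
      (\<lambda>t. \<Sum>k\<in>S \<union> T. ((if k \<in> S then c k else 0) + (if k \<in> T then d k else 0)) * fourier n k t)"
    using S T by (simp add: sum.distrib distrib_right)
  with S T show ?case by (intro exI conjI) auto
qed

text \<open>The link to Stone-Weierstrass: a real polynomial in the two coordinates of the plane,
  restricted to the unit circle, is a trigonometric polynomial. The factor \<open>2 ^ n\<close>
  stretches the arc to one full turn. A linear g takes the value cos * g 1 + sin * g \<i>, and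
  Euler's formulas give the two coefficients.\<close>

lemma trig_poly_cis:
  assumes "real_polynomial_function g"
  shows "trig_poly n (\<lambda>t. of_real (g (cis (2 ^ n * t))))"
  using assms
proof induction
  case (linear g)
  then interpret bounded_linear g .
  have "complex_of_real (g (cis (2 ^ n * t))) =
      ((g 1 - \<i> * g \<i>) / 2) * fourier n 1 t + ((g 1 + \<i> * g \<i>) / 2) * fourier n (-1) t" for t
  proof -
    have "cis (2 ^ n * t) = cos (2 ^ n * t) *\<^sub>R 1 + sin (2 ^ n * t) *\<^sub>R \<i>"
      by (simp add: complex_eq_iff)
    then have "g (cis (2 ^ n * t)) = cos (2 ^ n * t) * g 1 + sin (2 ^ n * t) * g \<i>"
      by (simp only: add scaleR real_scaleR_def)
    moreover have "fourier n 1 t = cis (2 ^ n * t)" "fourier n (-1) t = cis (- (2 ^ n * t))"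
      by (simp_all add: fourier_def cis_conv_exp mult.assoc)
    ultimately show ?thesis by (simp add: complex_eq_iff field_simps)
  qed
  then show ?case by (simp only: trig_poly.add[OF trig_poly.monom trig_poly.monom])
next
  case (const c)
  show ?case by (rule trig_poly_const)
next
  case (add f g)
  then show ?case using trig_poly.add by simp
next
  case (mult f g)
  then show ?case using trig_poly_mult by simp
qed

section \<open>The closure of the trigonometric polynomials in the quadratic mean\<close>

definition trig_approx :: "nat \<Rightarrow> (real \<Rightarrow> complex) \<Rightarrow> bool" where
  "trig_approx n f \<longleftrightarrow> f \<in> L2 (arc_measure n) \<and>
     (\<forall>\<epsilon>>0. \<exists>p. trig_poly n p \<and> (\<integral>t. (cmod (f t - p t))\<^sup>2 \<partial>arc_measure n) < \<epsilon>)"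

lemma trig_approx_limit:
  assumes f: "f \<in> L2 (arc_measure n)"
    and lim: "\<And>\<epsilon>. \<epsilon> > 0 \<Longrightarrow> \<exists>g. trig_approx n g \<and> (\<integral>t. (cmod (f t - g t))\<^sup>2 \<partial>arc_measure n) < \<epsilon>"
  shows "trig_approx n f"
  unfolding trig_approx_def
proof (intro conjI f allI impI)
  fix \<epsilon> :: real assume "\<epsilon> > 0"
  then obtain g where g: "trig_approx n g" "(\<integral>t. (cmod (f t - g t))\<^sup>2 \<partial>arc_measure n) < \<epsilon> / 4"
    using lim[of "\<epsilon> / 4"] by auto
  then obtain p where p: "trig_poly n p" "(\<integral>t. (cmod (g t - p t))\<^sup>2 \<partial>arc_measure n) < \<epsilon> / 4"
    using \<open>\<epsilon> > 0\<close> unfolding trig_approx_def by (meson divide_pos_pos zero_less_numeral)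
  have "g \<in> L2 (arc_measure n)" using g by (simp add: trig_approx_def)
  from L2_norm_add_sq_le[OF L2_diff[OF f this] L2_diff[OF this trig_poly_L2[OF p(1)]]]
  show "\<exists>p. trig_poly n p \<and> (\<integral>t. (cmod (f t - p t))\<^sup>2 \<partial>arc_measure n) < \<epsilon>"
    using g p by (intro exI[of _ p]) simp
qed

lemma trig_approx_add:
  assumes "trig_approx n f" "trig_approx n g"
  shows "trig_approx n (\<lambda>t. f t + g t)"
  unfolding trig_approx_def
proof (intro conjI allI impI)
  have L2: "f \<in> L2 (arc_measure n)" "g \<in> L2 (arc_measure n)"
    using assms by (auto simp: trig_approx_def)
  then show "(\<lambda>t. f t + g t) \<in> L2 (arc_measure n)" by (rule L2_add)
  fix \<epsilon> :: real assume "\<epsilon> > 0"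
  then obtain p q where p: "trig_poly n p" "(\<integral>t. (cmod (f t - p t))\<^sup>2 \<partial>arc_measure n) < \<epsilon> / 4"
    and q: "trig_poly n q" "(\<integral>t. (cmod (g t - q t))\<^sup>2 \<partial>arc_measure n) < \<epsilon> / 4"
    using assms unfolding trig_approx_def by (meson divide_pos_pos zero_less_numeral)
  have "(\<integral>t. (cmod (f t - p t + (g t - q t)))\<^sup>2 \<partial>arc_measure n) < \<epsilon>"
    using L2_norm_add_sq_le[OF L2_diff[OF L2(1) trig_poly_L2[OF p(1)]] L2_diff[OF L2(2) trig_poly_L2[OF q(1)]]]
      p q by simp
  then show "\<exists>p. trig_poly n p \<and> (\<integral>t. (cmod (f t + g t - p t))\<^sup>2 \<partial>arc_measure n) < \<epsilon>"
    using trig_poly.add[OF p(1) q(1)] by (intro exI[of _ "\<lambda>t. p t + q t"]) (simp add: algebra_simps)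
qed

lemma trig_poly_approx: "trig_poly n p \<Longrightarrow> trig_approx n p"
  unfolding trig_approx_def by (intro conjI allI impI exI[of _ p] trig_poly_L2) simp_all

lemma trig_approx_scale:
  assumes "trig_approx n f"
  shows "trig_approx n (\<lambda>t. c * f t)"
  unfolding trig_approx_def
proof (intro conjI allI impI)
  have L2: "f \<in> L2 (arc_measure n)" using assms by (auto simp: trig_approx_def)
  then show "(\<lambda>t. c * f t) \<in> L2 (arc_measure n)" by (rule L2_scale)
  fix \<epsilon> :: real assume "\<epsilon> > 0"
  then have "\<epsilon> / ((cmod c)\<^sup>2 + 1) > 0" by (intro divide_pos_pos add_nonneg_pos) auto
  then obtain p where p: "trig_poly n p"
      "(\<integral>t. (cmod (f t - p t))\<^sup>2 \<partial>arc_measure n) < \<epsilon> / ((cmod c)\<^sup>2 + 1)"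
    using assms unfolding trig_approx_def by blast
  have "(\<integral>t. (cmod (c * f t - c * p t))\<^sup>2 \<partial>arc_measure n) =
      (cmod c)\<^sup>2 * (\<integral>t. (cmod (f t - p t))\<^sup>2 \<partial>arc_measure n)"
    by (simp add: norm_mult power_mult_distrib flip: right_diff_distrib)
  also have "\<dots> \<le> (cmod c)\<^sup>2 * (\<epsilon> / ((cmod c)\<^sup>2 + 1))"
    using p by (intro mult_left_mono) auto
  also have "\<dots> < \<epsilon>"
    using \<open>\<epsilon> > 0\<close> by (simp add: field_simps add_pos_nonneg)
  finally show "\<exists>p. trig_poly n p \<and> (\<integral>t. (cmod (c * f t - p t))\<^sup>2 \<partial>arc_measure n) < \<epsilon>"
    using trig_poly_mult[OF trig_poly_const p(1)] by (intro exI[of _ "\<lambda>t. c * p t"]) simp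
qed

lemma trig_approx_sum:
  "(\<And>i. i \<in> I \<Longrightarrow> trig_approx n (f i)) \<Longrightarrow> trig_approx n (\<lambda>t. \<Sum>i\<in>I. f i t)"
proof (induction I rule: infinite_finite_induct)
  case (insert i I)
  then show ?case by (simp add: trig_approx_add)
qed (simp_all add: trig_poly_approx trig_poly_const)

text \<open>The one limit theorem behind all later extensions: continuous functions, closed sets,
  disjoint unions and limits of simple functions are dominated limits, and a constant sequence gives
  invariance under changes on null sets.\<close>

lemma trig_approx_dominated:
  assumes g: "\<And>i. trig_approx n (g i)"
    and f [measurable]: "f \<in> borel_measurable (arc_measure n)"
    and w: "integrable (arc_measure n) (\<lambda>t. (w t)\<^sup>2)"
    and lim: "AE t in arc_measure n. (\<lambda>i. g i t) \<longlonglongrightarrow> f t"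
    and bnd: "\<And>i t. cmod (g i t) \<le> w t"
  shows "trig_approx n f"
proof (rule trig_approx_limit)
  have g_L2: "g i \<in> L2 (arc_measure n)" for i using g[of i] by (simp add: trig_approx_def)
  then have [measurable]: "g i \<in> borel_measurable (arc_measure n)" for i by (rule L2_measurable)
  have f_bnd: "AE t in arc_measure n. cmod (f t) \<le> w t"
    using lim by eventually_elim (rule LIMSEQ_le_const2[OF tendsto_norm], use bnd in auto)
  have "integrable (arc_measure n) (\<lambda>t. (cmod (f t))\<^sup>2)"
  proof (rule Bochner_Integration.integrable_bound[OF w])
    show "(\<lambda>t. (cmod (f t))\<^sup>2) \<in> borel_measurable (arc_measure n)"
      by measurable
    show "AE t in arc_measure n. norm ((cmod (f t))\<^sup>2) \<le> norm ((w t)\<^sup>2)"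
      using f_bnd by eventually_elim (simp add: power_mono)
  qed
  then show "f \<in> L2 (arc_measure n)" using f by (simp add: L2_def)
  have "(\<lambda>i. \<integral>t. (cmod (f t - g i t))\<^sup>2 \<partial>arc_measure n) \<longlonglongrightarrow> (\<integral>t. 0 \<partial>arc_measure n)"
  proof (rule integral_dominated_convergence[where w = "\<lambda>t. 4 * (w t)\<^sup>2"])
    show "AE t in arc_measure n. (\<lambda>i. (cmod (f t - g i t))\<^sup>2) \<longlonglongrightarrow> 0"
      using lim
    proof eventually_elim
      case (elim t)
      then have "(\<lambda>i. (cmod (f t - g i t))\<^sup>2) \<longlonglongrightarrow> (cmod (f t - f t))\<^sup>2"
        by (intro tendsto_intros)
      then show ?case by simp
    qed
    show "AE t in arc_measure n. norm ((cmod (f t - g i t))\<^sup>2) \<le> 4 * (w t)\<^sup>2" for i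
      using f_bnd
    proof eventually_elim
      case (elim t)
      have "cmod (f t - g i t) \<le> 2 * w t"
        using norm_triangle_ineq4[of "f t" "g i t"] elim bnd[of i t] by linarith
      then have "(cmod (f t - g i t))\<^sup>2 \<le> (2 * w t)\<^sup>2" by (intro power_mono) auto
      then show ?case by (simp add: power_mult_distrib)
    qed
  qed (use w in auto)
  then have "eventually (\<lambda>i. (\<integral>t. (cmod (f t - g i t))\<^sup>2 \<partial>arc_measure n) < \<epsilon>) sequentially" if "\<epsilon> > 0" for \<epsilon>
    using that by (auto dest: order_tendstoD)
  then show "\<exists>g. trig_approx n g \<and> (\<integral>t. (cmod (f t - g t))\<^sup>2 \<partial>arc_measure n) < \<epsilon>" if "\<epsilon> > 0" for \<epsilon>
    using g that by (meson eventually_happens trivial_limit_sequentially)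
qed

lemma cis_arc_measurable [measurable]: "(\<lambda>t. cis (2 ^ n * t)) \<in> borel_measurable (arc_measure n)"
proof -
  have "continuous_on UNIV (\<lambda>t::real. cis (2 ^ n * t))" by (intro continuous_intros)
  then show ?thesis by (simp add: borel_measurable_continuous_onI cong: measurable_cong_sets)
qed

lemma integrable_arc_const: "integrable (arc_measure n) (\<lambda>t. c :: real)"
  by (rule finite_measure.integrable_const[OF finite_arc_measure])

lemma trig_approx_continuous:
  assumes h: "continuous_on UNIV h"
  shows "trig_approx n (\<lambda>t. of_real (h (cis (2 ^ n * t))))"
proof -
  have "\<exists>g. real_polynomial_function g \<and> (\<forall>z\<in>sphere 0 1. \<bar>h z - g z\<bar> < inverse (Suc i))" for i
    using Stone_Weierstrass_real_polynomial_function[of "sphere 0 1 :: complex set" h "inverse (Suc i)"]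
      continuous_on_subset[OF h] by (metis compact_sphere inverse_positive_iff_positive of_nat_0_less_iff subset_UNIV zero_less_Suc)
  then obtain g where g: "\<And>i. real_polynomial_function (g i)"
      "\<And>i z. z \<in> sphere 0 1 \<Longrightarrow> \<bar>h z - g i z\<bar> < inverse (Suc i)" by metis
  have "bounded (h ` sphere 0 1)"
    using continuous_on_subset[OF h] by (intro compact_imp_bounded compact_continuous_image) auto
  then obtain C where C: "\<And>z. z \<in> sphere 0 1 \<Longrightarrow> \<bar>h z\<bar> \<le> C"
    unfolding bounded_iff by (metis imageI real_norm_def)
  have [measurable]: "h \<in> borel_measurable borel" by (rule borel_measurable_continuous_onI[OF h])
  have [simp]: "cis x \<in> sphere 0 1" for x by simp
  show ?thesis
  proof (rule trig_approx_dominated)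
    show "trig_approx n (\<lambda>t. of_real (g i (cis (2 ^ n * t))))" for i
      by (intro trig_poly_approx trig_poly_cis g)
    show "cmod (of_real (g i (cis (2 ^ n * t)))) \<le> C + 1" for i t
    proof -
      have "inverse (real (Suc i)) \<le> 1" by (simp add: field_simps)
      then show ?thesis using g(2)[of "cis (2 ^ n * t)" i] C[of "cis (2 ^ n * t)"] by simp
    qed
    have "(\<lambda>i. g i z) \<longlonglongrightarrow> h z" if "z \<in> sphere 0 1" for z
    proof (rule LIM_zero_cancel, rule Lim_null_comparison[OF _ LIMSEQ_inverse_real_of_nat])
      show "\<forall>\<^sub>F i in sequentially. norm (g i z - h z) \<le> inverse (real (Suc i))"
        using g(2)[OF that] by (intro always_eventually) (auto simp: abs_minus_commute intro: less_imp_le)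
    qed
    then show "AE t in arc_measure n. (\<lambda>i. complex_of_real (g i (cis (2 ^ n * t)))) \<longlonglongrightarrow> of_real (h (cis (2 ^ n * t)))"
      by (intro AE_I2 tendsto_of_real) simp
  qed (auto intro: integrable_arc_const)
qed

text \<open>Dynkin's argument, with the closed sets as an intersection-stable generator of the Borel
  sets. The sets live in the plane rather than on the arc so that in the closed case continuous
  functions of \<open>cis\<close> are available, which respect the gluing of the endpoints.\<close>

lemma trig_approx_indicator_cis:
  assumes "A \<in> sets (borel :: complex measure)"
  shows "trig_approx n (\<lambda>t. indicator A (cis (2 ^ n * t)))"
proof -
  have "Int_stable (Collect closed :: complex set set)"
    by (auto simp: Int_stable_def)
  moreover have "(Collect closed :: complex set set) \<subseteq> Pow UNIV" by simp
  moreover have "A \<in> sigma_sets UNIV (Collect closed)" using assms by (simp add: borel_eq_closed)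
  ultimately show ?thesis
  proof (induction rule: sigma_sets_induct_disjoint)
    case (basic A)
    then have A: "closed A" by simp
    show ?case
    proof (cases "A = {}")
      case True
      then show ?thesis using trig_poly_approx[OF trig_poly_const] by simp
    next
      case False
      \<comment> \<open>These continuous functions decrease to the indicator of the closed set A.
        The empty set is treated apart because \<open>infdist\<close> to it is 0 by convention,
        which would make h constantly 1.\<close>
      define h where "h i z = max 0 (1 - real i * infdist z A)" for i and z :: complex
      have [measurable]: "A \<in> sets borel" using A by simp
      show ?thesis
      proof (rule trig_approx_dominated)
        show "trig_approx n (\<lambda>t. of_real (h i (cis (2 ^ n * t))))" for i
          by (intro trig_approx_continuous) (auto simp: h_def intro!: continuous_intros)
        show "cmod (of_real (h i (cis (2 ^ n * t)))) \<le> 1" for i t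
          using infdist_nonneg[of "cis (2 ^ n * t)" A] by (simp add: h_def)
        have "(\<lambda>i. h i z) \<longlonglongrightarrow> indicator A z" for z
        proof (cases "z \<in> A")
          case True
          then show ?thesis by (simp add: h_def)
        next
          case z: False
          then have pos: "infdist z A > 0" using infdist_pos_not_in_closed[OF A False] by simp
          have "eventually (\<lambda>i. real i > 1 / infdist z A) sequentially"
            using eventually_gt_at_top[of "nat \<lceil>1 / infdist z A\<rceil>"] by eventually_elim linarith
          then have "eventually (\<lambda>i. h i z = 0) sequentially"
            by eventually_elim (use pos in \<open>auto simp: h_def field_simps\<close>)
          then show ?thesis using z by (simp add: tendsto_eventually)
        qed
        moreover have "complex_of_real (indicator A z) = indicator A z" for z
          by (simp add: indicator_def)
        ultimately show "AE t in arc_measure n. (\<lambda>i. complex_of_real (h i (cis (2 ^ n * t)))) \<longlonglongrightarrow> indicator A (cis (2 ^ n * t))"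
          by (intro AE_I2) (metis tendsto_of_real)
        show "(\<lambda>t. indicator A (cis (2 ^ n * t)) :: complex) \<in> borel_measurable (arc_measure n)"
          by measurable
      qed (simp add: integrable_arc_const)
    qed
  next
    case empty
    show ?case using trig_poly_approx[OF trig_poly_const] by simp
  next
    case (compl A)
    have "trig_approx n (\<lambda>t. 1 + (- 1) * indicator A (cis (2 ^ n * t)))"
      by (intro trig_approx_add trig_approx_scale compl trig_poly_approx trig_poly_const)
    then show ?case by (simp add: indicator_compl Compl_eq_Diff_UNIV[symmetric])
  next
    case (union A)
    have [measurable]: "A i \<in> sets borel" for i
      using union(2) by (auto simp: borel_eq_closed)
    show ?case
    proof (rule trig_approx_dominated)
      have eq: "(\<Sum>i<k. indicator (A i) z) = (indicator (\<Union>i<k. A i) z :: complex)" for k z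
        using union(1) by (intro indicator_UN_disjoint[symmetric]) (auto intro: disjoint_family_on_mono)
      show "trig_approx n (\<lambda>t. \<Sum>i<k. indicator (A i) (cis (2 ^ n * t)))" for k
        by (intro trig_approx_sum union)
      show "cmod (\<Sum>i<k. indicator (A i) (cis (2 ^ n * t))) \<le> 1" for k t
        unfolding eq by (simp add: indicator_def)
      show "AE t in arc_measure n. (\<lambda>k. \<Sum>i<k. indicator (A i) (cis (2 ^ n * t))) \<longlonglongrightarrow>
          (indicator (\<Union>i. A i) (cis (2 ^ n * t)) :: complex)"
        unfolding eq by (intro AE_I2 LIMSEQ_indicator_UN)
      have "(\<Union>i. A i) \<in> sets borel" by auto
      then show "(\<lambda>t. indicator (\<Union>i. A i) (cis (2 ^ n * t)) :: complex) \<in> borel_measurable (arc_measure n)"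
        by (intro measurable_compose[OF cis_arc_measurable] borel_measurable_indicator)
    qed (simp add: integrable_arc_const)
  qed
qed

lemma trig_approx_cong_AE:
  assumes "trig_approx n f" "g \<in> borel_measurable (arc_measure n)" "AE t in arc_measure n. f t = g t"
  shows "trig_approx n g"
proof (rule trig_approx_dominated[where g = "\<lambda>_. f" and w = "\<lambda>t. cmod (f t)"])
  show "integrable (arc_measure n) (\<lambda>t. (cmod (f t))\<^sup>2)"
    using assms(1) by (auto simp: trig_approx_def dest: L2_sq_integrable)
qed (use assms in \<open>auto elim: eventually_mono\<close>)

text \<open>On the arc, t -> cis (2^n t) is injective apart from the two endpoints, which both go to
  -1 and form a null set. Up to that null set every Borel set of the arc is therefore the preimage
  of a Borel set of the plane.\<close>

lemma trig_approx_indicator: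
  assumes B [measurable]: "B \<in> sets borel"
  shows "trig_approx n (indicator B)"
proof -
  \<comment> \<open>an everywhere defined Borel function with \<open>arg (cis x) = x\<close> for \<open>\<bar>x\<bar> < pi\<close>\<close>
  define arg where "arg z = (if 0 \<le> Im z then 1 else - 1) * arccos (max (- 1) (min 1 (Re z)))" for z
  \<comment> \<open>Clamping Re z to [-1, 1] is what makes \<open>arccos\<close> continuous on the
    whole plane.\<close>
  have "continuous_on UNIV (\<lambda>z. arccos (max (- 1) (min 1 (Re z))))"
    by (intro continuous_intros) auto
  then have [measurable]: "arg \<in> borel_measurable borel"
    unfolding arg_def by (auto dest!: borel_measurable_continuous_onI)
  define A where "A = {z \<in> space borel. arg z / 2 ^ n \<in> B}"
  have [measurable]: "A \<in> sets borel" unfolding A_def by measurable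
  have arg: "arg (cis x) = x" if x: "\<bar>x\<bar> < pi" for x
  proof (cases "x \<ge> 0")
    case True
    then show ?thesis using x by (simp add: arg_def sin_ge_zero arccos_cos)
  next
    case False
    then have "sin (- x) > 0" using x by (intro sin_gt_zero) auto
    then show ?thesis using False x arccos_cos[of "- x"] by (simp add: arg_def)
  qed
  have "AE t in lborel. t \<noteq> pi / 2 ^ n \<and> t \<noteq> - (pi / 2 ^ n)"
    using AE_lborel_singleton by auto
  then have "AE t in lborel. t \<in> {- (pi / 2 ^ n)..pi / 2 ^ n} \<longrightarrow> \<bar>2 ^ n * t\<bar> < pi"
    by eventually_elim (auto simp: abs_less_iff field_simps)
  then have AE: "AE t in arc_measure n. \<bar>2 ^ n * t\<bar> < pi"
    unfolding arc_measure_def by (intro AE_uniform_measureI) auto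
  show ?thesis
  proof (rule trig_approx_cong_AE[OF trig_approx_indicator_cis[of A]])
    show "AE t in arc_measure n. indicator A (cis (2 ^ n * t)) = (indicator B t :: complex)"
      using AE by eventually_elim (simp add: A_def arg indicator_def)
  qed auto
qed

lemma L2_trig_approx:
  assumes f: "f \<in> L2 (arc_measure n)"
  shows "trig_approx n f"
proof -
  obtain F where F: "\<And>i. simple_function (arc_measure n) (F i)"
    "\<And>x. (\<lambda>i. F i x) \<longlonglongrightarrow> f x" "\<And>i x. cmod (F i x) \<le> 2 * cmod (f x)"
    using borel_measurable_implies_sequence_metric[OF L2_measurable[OF f], of 0] by auto
  have "trig_approx n (F i)" for i
  proof -
    have ind: "indicator A t *\<^sub>R y = y * indicator A t" for A t and y :: complex
      by (simp add: indicator_def)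
    have eq: "F i = (\<lambda>t. \<Sum>y\<in>range (F i). y * indicator (F i -` {y}) t)"
      using simple_function_indicator_representation_banach[OF F(1)[of i]]
      unfolding ind space_arc_measure Int_UNIV_right by (intro ext) blast
    show ?thesis
      using simple_functionD(2)[OF F(1)[of i]]
      by (subst eq, intro trig_approx_sum trig_approx_scale trig_approx_indicator) simp
  qed
  then show ?thesis
  proof (rule trig_approx_dominated[where g = F])
    show "integrable (arc_measure n) (\<lambda>t. (2 * cmod (f t))\<^sup>2)"
      using L2_sq_integrable[OF f] by (simp add: power_mult_distrib)
  qed (use F f in \<open>auto dest: L2_measurable\<close>)
qed

lemma L2_fourier_dense:
  assumes "f \<in> L2 (arc_measure n)" "\<epsilon> > 0"
  obtains S c where "finite S" "(\<integral>t. (cmod (f t - (\<Sum>k\<in>S. c k * fourier n k t)))\<^sup>2 \<partial>arc_measure n) < \<epsilon>"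
  using L2_trig_approx[OF assms(1)] assms(2) trig_poly_sum unfolding trig_approx_def by metis

section \<open>The Hilbert space of the gasket\<close>

lemma L2_inner_self: "L2_inner M f f = of_real (\<integral>x. (cmod (f x))\<^sup>2 \<partial>M)"
proof -
  have "cnj z * z = of_real ((cmod z)\<^sup>2)" for z
    by (simp only: complex_norm_square mult.commute)
  then show ?thesis unfolding L2_inner_def by (simp only: integral_complex_of_real)
qed

lemma L2_inner_cnj: "cnj (L2_inner M f g) = L2_inner M g f"
  unfolding L2_inner_def Bochner_Integration.integral_cnj[symmetric] by (simp add: mult.commute)

lemma L2_inner_add_right:
  "f \<in> L2 M \<Longrightarrow> g \<in> L2 M \<Longrightarrow> h \<in> L2 M \<Longrightarrow> L2_inner M f (\<lambda>x. g x + h x) = L2_inner M f g + L2_inner M f h"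
  unfolding L2_inner_def distrib_left
  by (intro Bochner_Integration.integral_add L2_inner_integrable)

lemma L2_inner_scale_right: "L2_inner M f (\<lambda>x. c * g x) = c * L2_inner M f g"
  unfolding L2_inner_def by (simp flip: integral_mult_right_zero add: mult_ac)

lemma L2_inner_zero [simp]: "L2_inner M (\<lambda>x. 0) f = 0" "L2_inner M f (\<lambda>x. 0) = 0"
  by (simp_all add: L2_inner_def)

lemma norm_L2_inner_le:
  assumes "f \<in> L2 M" "g \<in> L2 M"
  shows "cmod (L2_inner M f g) \<le> ((\<integral>x. (cmod (f x))\<^sup>2 \<partial>M) + (\<integral>x. (cmod (g x))\<^sup>2 \<partial>M)) / 2"
proof -
  note int = L2_sq_integrable[OF assms(1)] L2_sq_integrable[OF assms(2)]
  have "cmod (L2_inner M f g) \<le> (\<integral>x. cmod (cnj (f x) * g x) \<partial>M)"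
    unfolding L2_inner_def by (rule integral_norm_bound)
  also have "\<dots> \<le> (\<integral>x. ((cmod (f x))\<^sup>2 + (cmod (g x))\<^sup>2) / 2 \<partial>M)"
  proof (rule integral_mono)
    show "integrable M (\<lambda>x. cmod (cnj (f x) * g x))"
      by (intro integrable_norm L2_inner_integrable assms)
    show "integrable M (\<lambda>x. ((cmod (f x))\<^sup>2 + (cmod (g x))\<^sup>2) / 2)"
      using int by simp
  qed (rule norm_mult_le_sq)
  also have "\<dots> = ((\<integral>x. (cmod (f x))\<^sup>2 \<partial>M) + (\<integral>x. (cmod (g x))\<^sup>2 \<partial>M)) / 2"
    using int by simp
  finally show ?thesis .
qed

definition comp_inner :: "vec \<Rightarrow> vec \<Rightarrow> nat \<times> nat \<Rightarrow> complex" where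
  "comp_inner u v p = L2_inner (arc_measure (fst p)) (u p) (v p)"

definition comp_sq :: "vec \<Rightarrow> nat \<times> nat \<Rightarrow> real" where
  "comp_sq u p = (\<integral>t. (cmod (u p t))\<^sup>2 \<partial>arc_measure (fst p))"

lemma H_SG_iff: "u \<in> H_SG \<longleftrightarrow>
    (\<forall>p\<in>triangles. u p \<in> L2 (arc_measure (fst p))) \<and> comp_sq u summable_on triangles"
  by (simp add: H_SG_def comp_sq_def case_prod_unfold cong: summable_on_cong)

lemma H_SG_L2: "u \<in> H_SG \<Longrightarrow> p \<in> triangles \<Longrightarrow> u p \<in> L2 (arc_measure (fst p))"
  by (simp add: H_SG_iff)

lemma inner_SG_eq: "inner_SG u v = (\<Sum>\<^sub>\<infinity>p\<in>triangles. comp_inner u v p)"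
  by (simp add: inner_SG_def comp_inner_def case_prod_unfold)

lemma comp_sq_nonneg: "comp_sq u p \<ge> 0"
  by (simp add: comp_sq_def)

lemma comp_inner_self: "comp_inner u u p = of_real (comp_sq u p)"
  by (simp add: comp_inner_def comp_sq_def L2_inner_self)

lemma comp_inner_summable:
  assumes "u \<in> H_SG" "v \<in> H_SG"
  shows "comp_inner u v summable_on triangles"
proof (rule abs_summable_summable, rule summable_on_comparison_test)
  show "(\<lambda>p. (comp_sq u p + comp_sq v p) * (1 / 2)) summable_on triangles"
    using assms by (intro summable_on_cmult_left summable_on_add) (auto simp: H_SG_iff)
  show "cmod (comp_inner u v p) \<le> (comp_sq u p + comp_sq v p) * (1 / 2)" if "p \<in> triangles" for p
    unfolding comp_inner_def comp_sq_def
    using norm_L2_inner_le[OF H_SG_L2[OF assms(1) that] H_SG_L2[OF assms(2) that]] by simp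
qed auto

lemma H_SG_add:
  assumes "u \<in> H_SG" "v \<in> H_SG"
  shows "(\<lambda>p t. u p t + v p t) \<in> H_SG"
  unfolding H_SG_iff
proof (intro conjI ballI)
  show "(\<lambda>t. u p t + v p t) \<in> L2 (arc_measure (fst p))" if "p \<in> triangles" for p
    by (intro L2_add H_SG_L2 assms that)
  show "comp_sq (\<lambda>p t. u p t + v p t) summable_on triangles"
  proof (rule summable_on_comparison_test)
    show "(\<lambda>p. 2 * comp_sq u p + 2 * comp_sq v p) summable_on triangles"
      using assms by (intro summable_on_cmult_right summable_on_add) (auto simp: H_SG_iff)
    show "comp_sq (\<lambda>p t. u p t + v p t) p \<le> 2 * comp_sq u p + 2 * comp_sq v p" if "p \<in> triangles" for p
      unfolding comp_sq_def by (intro L2_norm_add_sq_le H_SG_L2 assms that)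
  qed (rule comp_sq_nonneg)
qed

lemma H_SG_scale:
  assumes "u \<in> H_SG"
  shows "(\<lambda>p t. c * u p t) \<in> H_SG"
proof -
  have "comp_sq (\<lambda>p t. c * u p t) = (\<lambda>p. (cmod c)\<^sup>2 * comp_sq u p)"
    by (simp add: comp_sq_def norm_mult power_mult_distrib fun_eq_iff)
  then show ?thesis
    using assms by (auto simp: H_SG_iff L2_scale intro: summable_on_cmult_right)
qed

lemma H_SG_zero: "(\<lambda>p t. 0) \<in> H_SG"
  by (simp add: H_SG_iff L2_zero comp_sq_def[abs_def])

lemma H_SG_sum: "(\<And>i. i \<in> I \<Longrightarrow> u i \<in> H_SG) \<Longrightarrow> (\<lambda>p t. \<Sum>i\<in>I. u i p t) \<in> H_SG"
  by (induction I rule: infinite_finite_induct) (simp_all add: H_SG_zero H_SG_add)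

lemma inner_SG_cnj: "cnj (inner_SG u v) = inner_SG v u"
  by (simp add: inner_SG_eq comp_inner_def L2_inner_cnj flip: infsum_cnj)

lemma inner_SG_scale_right: "inner_SG u (\<lambda>p t. c * v p t) = c * inner_SG u v"
  by (simp add: inner_SG_eq comp_inner_def L2_inner_scale_right infsum_cmult_right')

lemma inner_SG_add_right:
  assumes "u \<in> H_SG" "v \<in> H_SG" "w \<in> H_SG"
  shows "inner_SG u (\<lambda>p t. v p t + w p t) = inner_SG u v + inner_SG u w"
proof -
  have "inner_SG u (\<lambda>p t. v p t + w p t) = (\<Sum>\<^sub>\<infinity>p\<in>triangles. comp_inner u v p + comp_inner u w p)"
    unfolding inner_SG_eq comp_inner_def
    by (intro infsum_cong L2_inner_add_right H_SG_L2 assms)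
  then show ?thesis
    using assms by (simp add: inner_SG_eq infsum_add comp_inner_summable)
qed

lemma inner_SG_zero_right: "inner_SG u (\<lambda>p t. 0) = 0"
  by (simp add: inner_SG_eq comp_inner_def)

lemma inner_SG_sum_right:
  assumes "u \<in> H_SG"
  shows "(\<And>i. i \<in> I \<Longrightarrow> v i \<in> H_SG) \<Longrightarrow> inner_SG u (\<lambda>p t. \<Sum>i\<in>I. v i p t) = (\<Sum>i\<in>I. inner_SG u (v i))"
  by (induction I rule: infinite_finite_induct)
     (simp_all add: inner_SG_zero_right inner_SG_add_right H_SG_sum assms)

lemma inner_SG_add_left:
  assumes "u \<in> H_SG" "v \<in> H_SG" "w \<in> H_SG"
  shows "inner_SG (\<lambda>p t. v p t + w p t) u = inner_SG v u + inner_SG w u"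
  using arg_cong[OF inner_SG_add_right[OF assms], of cnj] by (simp only: inner_SG_cnj complex_cnj_add)

lemma inner_SG_scale_left: "inner_SG (\<lambda>p t. c * v p t) u = cnj c * inner_SG v u"
  using arg_cong[OF inner_SG_scale_right[of u c v], of cnj] by (simp only: inner_SG_cnj complex_cnj_mult)

lemma infsum_complex_of_real: "infsum (\<lambda>x. complex_of_real (f x)) A = of_real (infsum f A)"
  by (rule infsum_bounded_linear_strong[OF _ bounded_linear_of_real])
     (rule summable_on_bounded_linear_iff[OF bounded_linear_of_real bounded_linear_Re Re_complex_of_real])

section \<open>Bessel and Parseval for arbitrary orthonormal bases\<close>

definition normsq_SG :: "vec \<Rightarrow> real" where
  "normsq_SG u = (\<Sum>\<^sub>\<infinity>p\<in>triangles. comp_sq u p)"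

lemma inner_SG_self: "inner_SG u u = of_real (normsq_SG u)"
  by (simp add: inner_SG_eq normsq_SG_def comp_inner_self infsum_complex_of_real)

lemma normsq_SG_nonneg: "normsq_SG u \<ge> 0"
  unfolding normsq_SG_def by (intro infsum_nonneg comp_sq_nonneg)

lemma norm_SG_eq: "norm_SG u = sqrt (normsq_SG u)"
  by (simp add: norm_SG_def inner_SG_self)

text \<open>The free scalar c lets one expansion serve both the error of an approximation (c = -1)
  and the four vectors of polarization.\<close>

lemma normsq_SG_add_scale:
  assumes "u \<in> H_SG" "v \<in> H_SG"
  shows "complex_of_real (normsq_SG (\<lambda>p t. v p t + c * u p t)) =
    of_real (normsq_SG v) + c * inner_SG v u + cnj (c * inner_SG v u) + of_real ((cmod c)\<^sup>2 * normsq_SG u)"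
proof -
  have cu: "(\<lambda>p t. c * u p t) \<in> H_SG" by (rule H_SG_scale) fact
  have "cnj c * inner_SG u v = cnj (c * inner_SG v u)"
    by (simp add: inner_SG_cnj)
  then show ?thesis
    unfolding inner_SG_self[symmetric]
    by (simp add: inner_SG_add_right inner_SG_add_left inner_SG_scale_right inner_SG_scale_left
        assms cu H_SG_add algebra_simps)
       (simp add: inner_SG_self inner_SG_cnj complex_norm_square[unfolded of_real_power] mult_ac)
qed

text \<open>Completing the square isolates the choice of the coefficients in the last sum. Taking
  the inner products as coefficients gives Bessel; for arbitrary c, dropping that nonnegative sum
  shows that a good approximation forces the Bessel sum close to the full squared norm.\<close>

lemma orthonormal_approx_error:
  assumes B: "orthonormal_basis B" and u: "u \<in> H_SG" and S: "finite S" "S \<subseteq> B"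
  shows "normsq_SG (\<lambda>p t. u p t - (\<Sum>e\<in>S. c e * e p t)) =
    normsq_SG u - (\<Sum>e\<in>S. (cmod (inner_SG e u))\<^sup>2) + (\<Sum>e\<in>S. (cmod (c e - inner_SG e u))\<^sup>2)"
proof -
  have H: "e \<in> H_SG" if "e \<in> S" for e using B S that by (auto simp: orthonormal_basis_def)
  have ortho: "inner_SG e f = (if e = f then 1 else 0)" if "e \<in> S" "f \<in> S" for e f
    using B S(2) that unfolding orthonormal_basis_def by (meson subsetD)
  define s where "s = (\<lambda>p t. \<Sum>e\<in>S. c e * e p t)"
  have s: "s \<in> H_SG" unfolding s_def by (intro H_SG_sum H_SG_scale H)
  have ws: "inner_SG w s = (\<Sum>e\<in>S. c e * cnj (inner_SG e w))" if "w \<in> H_SG" for w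
    unfolding s_def by (subst inner_SG_sum_right) (auto simp: inner_SG_scale_right inner_SG_cnj that H H_SG_scale)
  have es: "inner_SG e s = c e" if "e \<in> S" for e
  proof -
    have "inner_SG e s = (\<Sum>f\<in>S. if e = f then c f else 0)"
      unfolding s_def
      by (subst inner_SG_sum_right) (auto simp: inner_SG_scale_right ortho that H H_SG_scale intro!: sum.cong)
    then show ?thesis using S that by simp
  qed
  have ss: "complex_of_real (normsq_SG s) = (\<Sum>e\<in>S. c e * cnj (c e))"
    using ws[OF s] by (simp add: inner_SG_self es)
  have "complex_of_real (normsq_SG (\<lambda>p t. u p t - (\<Sum>e\<in>S. c e * e p t))) =
      of_real (normsq_SG u) - inner_SG u s - cnj (inner_SG u s) + of_real (normsq_SG s)"
    using normsq_SG_add_scale[OF s u, of "- 1"] by (simp add: s_def)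
  also have "\<dots> = of_real (normsq_SG u) + (\<Sum>e\<in>S. c e * cnj (c e) - c e * cnj (inner_SG e u) - cnj (c e) * inner_SG e u)"
    unfolding ws[OF u] ss by (simp add: sum_subtractf)
  also have "(\<Sum>e\<in>S. c e * cnj (c e) - c e * cnj (inner_SG e u) - cnj (c e) * inner_SG e u) =
      (\<Sum>e\<in>S. of_real ((cmod (c e - inner_SG e u))\<^sup>2) - of_real ((cmod (inner_SG e u))\<^sup>2))"
    by (intro sum.cong refl) (simp only: complex_norm_square complex_cnj_diff, simp add: algebra_simps)
  finally have "complex_of_real (normsq_SG (\<lambda>p t. u p t - (\<Sum>e\<in>S. c e * e p t))) =
      of_real (normsq_SG u + (\<Sum>e\<in>S. (cmod (c e - inner_SG e u))\<^sup>2 - (cmod (inner_SG e u))\<^sup>2))"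
    by simp
  then show ?thesis unfolding of_real_eq_iff by (simp add: sum_subtractf)
qed

lemma bessel:
  assumes "orthonormal_basis B" "u \<in> H_SG" "finite S" "S \<subseteq> B"
  shows "(\<Sum>e\<in>S. (cmod (inner_SG e u))\<^sup>2) \<le> normsq_SG u"
  using orthonormal_approx_error[OF assms, of "\<lambda>e. inner_SG e u"]
    normsq_SG_nonneg[of "\<lambda>p t. u p t - (\<Sum>e\<in>S. inner_SG e u * e p t)"] by simp

lemma parseval_norm:
  assumes B: "orthonormal_basis B" and u: "u \<in> H_SG"
  shows "((\<lambda>e. (cmod (inner_SG e u))\<^sup>2) has_sum normsq_SG u) B"
  unfolding has_sum_def
proof (rule tendstoI)
  fix \<epsilon> :: real assume "\<epsilon> > 0"
  then have "sqrt \<epsilon> > 0" by simp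
  with B u obtain S c where S: "finite S" "S \<subseteq> B"
    and "norm_SG (\<lambda>p t. u p t - (\<Sum>e\<in>S. c e * e p t)) < sqrt \<epsilon>"
    unfolding orthonormal_basis_def by blast
  then have "normsq_SG (\<lambda>p t. u p t - (\<Sum>e\<in>S. c e * e p t)) < \<epsilon>"
    by (simp add: norm_SG_eq)
  then have S_err: "normsq_SG u - (\<Sum>e\<in>S. (cmod (inner_SG e u))\<^sup>2) < \<epsilon>"
    using orthonormal_approx_error[OF B u S, of c]
      sum_nonneg[of S "\<lambda>e. (cmod (c e - inner_SG e u))\<^sup>2"] by simp
  have "dist (\<Sum>e\<in>Y. (cmod (inner_SG e u))\<^sup>2) (normsq_SG u) < \<epsilon>"
    if Y: "finite Y" "S \<subseteq> Y" "Y \<subseteq> B" for Y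
  proof -
    have "(\<Sum>e\<in>S. (cmod (inner_SG e u))\<^sup>2) \<le> (\<Sum>e\<in>Y. (cmod (inner_SG e u))\<^sup>2)"
      using Y by (intro sum_mono2) auto
    then show ?thesis using S_err bessel[OF B u Y(1,3)] by (simp add: dist_real_def)
  qed
  then show "\<forall>\<^sub>F Y in finite_subsets_at_top B. dist (\<Sum>e\<in>Y. (cmod (inner_SG e u))\<^sup>2) (normsq_SG u) < \<epsilon>"
    using S unfolding eventually_finite_subsets_at_top by blast
qed

lemma polarization:
  "4 * (cnj a * b) = of_real ((cmod (b + a))\<^sup>2) - of_real ((cmod (b + (- 1) * a))\<^sup>2) +
    \<i> * (of_real ((cmod (b + \<i> * a))\<^sup>2) - of_real ((cmod (b + (- \<i>) * a))\<^sup>2))"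
  unfolding complex_norm_square by (simp add: algebra_simps)

lemma polarization_SG:
  assumes "u \<in> H_SG" "v \<in> H_SG"
  shows "4 * inner_SG u v = of_real (normsq_SG (\<lambda>p t. v p t + 1 * u p t)) -
     of_real (normsq_SG (\<lambda>p t. v p t + (- 1) * u p t)) +
     \<i> * (of_real (normsq_SG (\<lambda>p t. v p t + \<i> * u p t)) - of_real (normsq_SG (\<lambda>p t. v p t + (- \<i>) * u p t)))"
  unfolding normsq_SG_add_scale[OF assms] by (simp add: inner_SG_cnj algebra_simps)

text \<open>Polarization is linear in the four squared norms, so the four instances of
  \<open>parseval_norm\<close> for v + c u, with c = 1, -1, \<i>, - \<i>, combine to the sum for the
  inner product.\<close>

lemma parseval:
  assumes B: "orthonormal_basis B" and u: "u \<in> H_SG" and v: "v \<in> H_SG"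
  shows "((\<lambda>e. cnj (inner_SG e u) * inner_SG e v) has_sum inner_SG u v) B"
proof -
  have H: "e \<in> H_SG" if "e \<in> B" for e using B that by (auto simp: orthonormal_basis_def)
  have P: "((\<lambda>e. of_real ((cmod (inner_SG e v + c * inner_SG e u))\<^sup>2)) has_sum
      complex_of_real (normsq_SG (\<lambda>p t. v p t + c * u p t))) B" for c
  proof (rule has_sum_of_real)
    have "((\<lambda>e. (cmod (inner_SG e (\<lambda>p t. v p t + c * u p t)))\<^sup>2) has_sum
        normsq_SG (\<lambda>p t. v p t + c * u p t)) B"
      by (intro parseval_norm B H_SG_add H_SG_scale u v)
    then show "((\<lambda>e. (cmod (inner_SG e v + c * inner_SG e u))\<^sup>2) has_sum
        normsq_SG (\<lambda>p t. v p t + c * u p t)) B"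
      by (rule has_sum_cong[THEN iffD1, rotated])
         (simp add: inner_SG_add_right inner_SG_scale_right H u v H_SG_scale)
  qed
  have "((\<lambda>e. 4 * (cnj (inner_SG e u) * inner_SG e v)) has_sum 4 * inner_SG u v) B"
    unfolding polarization_SG[OF u v] diff_conv_add_uminus
    unfolding polarization diff_conv_add_uminus
    using P[of 1] P[of "- 1"] P[of \<i>] P[of "- \<i>"]
    by (intro has_sum_add has_sum_cmult_right has_sum_uminus[THEN iffD2]) simp_all
  then show ?thesis
    by (subst (asm) has_sum_cmult_right_iff) simp_all
qed

section \<open>The eigenbasis\<close>

definition single :: "nat \<times> nat \<Rightarrow> (real \<Rightarrow> complex) \<Rightarrow> vec" where
  "single p f = (\<lambda>p' t. if p' = p then f t else 0)"

definition basis_index :: "((nat \<times> nat) \<times> int) set" where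
  "basis_index = triangles \<times> UNIV"

definition basis_vec :: "(nat \<times> nat) \<times> int \<Rightarrow> vec" where
  "basis_vec q = single (fst q) (fourier (fst (fst q)) (snd q))"

definition eigval :: "(nat \<times> nat) \<times> int \<Rightarrow> real" where
  "eigval q = dirac_eigenvalue (fst (fst q)) (snd q)"

lemma single_apply: "single p f p = f" "p' \<noteq> p \<Longrightarrow> single p f p' = (\<lambda>t. 0)"
  by (simp_all add: single_def)

lemma comp_sq_single: "comp_sq (single p f) p' = (if p' = p then \<integral>t. (cmod (f t))\<^sup>2 \<partial>arc_measure (fst p) else 0)"
  by (simp add: comp_sq_def single_def)

lemma single_H_SG:
  assumes "f \<in> L2 (arc_measure (fst p))"
  shows "single p f \<in> H_SG"
  unfolding H_SG_iff
proof (intro conjI ballI)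
  show "single p f p' \<in> L2 (arc_measure (fst p'))" for p'
    by (cases "p' = p") (simp_all add: single_apply assms L2_zero)
  show "comp_sq (single p f) summable_on triangles"
    by (rule finite_nonzero_values_imp_summable_on, rule finite_subset[of _ "{p}"]) (auto simp: comp_sq_single)
qed

lemma inner_SG_single:
  assumes "p \<in> triangles"
  shows "inner_SG (single p f) u = L2_inner (arc_measure (fst p)) f (u p)"
proof -
  have "inner_SG (single p f) u = (\<Sum>\<^sub>\<infinity>p'\<in>{p}. comp_inner (single p f) u p')"
    unfolding inner_SG_eq using assms
    by (intro infsum_cong_neutral) (auto simp: comp_inner_def single_apply)
  then show ?thesis by (simp add: comp_inner_def single_apply)
qed

lemma normsq_SG_single:
  assumes "p \<in> triangles"
  shows "normsq_SG (single p f) = (\<integral>t. (cmod (f t))\<^sup>2 \<partial>arc_measure (fst p))"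
proof -
  have "normsq_SG (single p f) = (\<Sum>\<^sub>\<infinity>p'\<in>{p}. comp_sq (single p f) p')"
    unfolding normsq_SG_def using assms
    by (intro infsum_cong_neutral) (auto simp: comp_sq_single)
  then show ?thesis by (simp add: comp_sq_single)
qed

lemma basis_vec_H_SG: "basis_vec q \<in> H_SG"
  unfolding basis_vec_def by (intro single_H_SG fourier_in_L2)

lemma inner_basis_vec:
  assumes "q \<in> basis_index"
  shows "inner_SG (basis_vec q) u = L2_inner (arc_measure (fst (fst q))) (fourier (fst (fst q)) (snd q)) (u (fst q))"
  using assms unfolding basis_vec_def basis_index_def by (intro inner_SG_single) auto

lemma inner_basis_vec_basis_vec:
  assumes "q \<in> basis_index" "r \<in> basis_index"
  shows "inner_SG (basis_vec q) (basis_vec r) = (if q = r then 1 else 0)"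
proof (cases "fst q = fst r")
  case True
  then show ?thesis
    unfolding inner_basis_vec[OF assms(1)]
    by (cases q; cases r) (auto simp: basis_vec_def single_apply fourier_orthonormal)
next
  case False
  then show ?thesis
    unfolding inner_basis_vec[OF assms(1)] by (auto simp: basis_vec_def single_apply)
qed

lemma inj_on_basis_vec: "inj_on basis_vec basis_index"
  using inner_basis_vec_basis_vec by (metis (full_types) inj_onI zero_neq_one)

lemma trig_approx_H_SG:
  assumes u: "u \<in> H_SG" and "\<epsilon> > 0"
  obtains Q c where "finite Q" "Q \<subseteq> basis_index"
    "normsq_SG (\<lambda>p t. u p t - (\<Sum>q\<in>Q. c q * basis_vec q p t)) < \<epsilon>"
proof -
  have summ: "comp_sq u summable_on triangles" using u by (simp add: H_SG_iff)
  from infsum_finite_approximation[OF this, of "\<epsilon> / 4"] \<open>\<epsilon> > 0\<close>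
  obtain T where T: "finite T" "T \<subseteq> triangles" "dist (sum (comp_sq u) T) (normsq_SG u) \<le> \<epsilon> / 4"
    by (auto simp: normsq_SG_def)
  \<comment> \<open>The components outside T cost at most \<epsilon>/4 and those in T at most
    \<epsilon>/2 together; adding 1 keeps the denominator positive when T is empty.\<close>
  define \<delta> where "\<delta> = \<epsilon> / (2 * (card T + 1))"
  have \<delta>: "\<delta> > 0" "card T * \<delta> \<le> \<epsilon> / 2" using \<open>\<epsilon> > 0\<close> by (auto simp: \<delta>_def field_simps)
  have "\<forall>p\<in>T. \<exists>x. finite (fst x) \<and>
      (\<integral>t. (cmod (u p t - (\<Sum>k\<in>fst x. snd x k * fourier (fst p) k t)))\<^sup>2 \<partial>arc_measure (fst p)) < \<delta>"
  proof
    fix p assume "p \<in> T"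
    then have "p \<in> triangles" using T by blast
    from L2_fourier_dense[OF H_SG_L2[OF u this] \<delta>(1)] obtain S c where "finite S"
      "(\<integral>t. (cmod (u p t - (\<Sum>k\<in>S. c k * fourier (fst p) k t)))\<^sup>2 \<partial>arc_measure (fst p)) < \<delta>" .
    then show "\<exists>x. finite (fst x) \<and>
        (\<integral>t. (cmod (u p t - (\<Sum>k\<in>fst x. snd x k * fourier (fst p) k t)))\<^sup>2 \<partial>arc_measure (fst p)) < \<delta>"
      by (intro exI[of _ "(S, c)"]) simp
  qed
  from bchoice[OF this] obtain x where x: "\<forall>p\<in>T. finite (fst (x p)) \<and>
      (\<integral>t. (cmod (u p t - (\<Sum>k\<in>fst (x p). snd (x p) k * fourier (fst p) k t)))\<^sup>2 \<partial>arc_measure (fst p)) < \<delta>" ..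
  define S where "S p = fst (x p)" for p
  define c where "c p = snd (x p)" for p
  have S: "\<And>p. p \<in> T \<Longrightarrow> finite (S p)"
    "\<And>p. p \<in> T \<Longrightarrow> (\<integral>t. (cmod (u p t - (\<Sum>k\<in>S p. c p k * fourier (fst p) k t)))\<^sup>2 \<partial>arc_measure (fst p)) < \<delta>"
    using x by (simp_all add: S_def c_def)
  define Q where "Q = (SIGMA p:T. S p)"
  define w where "w = (\<lambda>p t. u p t - (\<Sum>q\<in>Q. c (fst q) (snd q) * basis_vec q p t))"
  have Q: "finite Q" "Q \<subseteq> basis_index"
    using T S by (auto simp: Q_def basis_index_def)
  have sum_Q: "(\<Sum>q\<in>Q. c (fst q) (snd q) * basis_vec q p t) =
      (if p \<in> T then \<Sum>k\<in>S p. c p k * fourier (fst p) k t else 0)" for p t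
  proof -
    have "(\<Sum>q\<in>Q. c (fst q) (snd q) * basis_vec q p t) =
        (\<Sum>p'\<in>T. \<Sum>k\<in>S p'. c p' k * basis_vec (p', k) p t)"
      unfolding Q_def using T S by (subst sum.Sigma) (auto simp: case_prod_unfold)
    also have "\<dots> = (\<Sum>p'\<in>T. if p' = p then \<Sum>k\<in>S p. c p k * fourier (fst p) k t else 0)"
      by (intro sum.cong refl) (auto simp: basis_vec_def single_def)
    finally show ?thesis using T by simp
  qed
  have w_H: "w \<in> H_SG"
  proof -
    have "(\<lambda>p t. u p t + (\<Sum>q\<in>Q. (- c (fst q) (snd q)) * basis_vec q p t)) \<in> H_SG"
      by (intro H_SG_add H_SG_sum H_SG_scale basis_vec_H_SG u)
    then show ?thesis by (simp add: w_def sum_negf)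
  qed
  then have summ_w: "comp_sq w summable_on triangles" by (simp add: H_SG_iff)
  have split: "infsum f triangles = sum f T + infsum f (triangles - T)"
    if "f summable_on triangles" for f :: "nat \<times> nat \<Rightarrow> real"
    using infsum_Un_disjoint[of f T "triangles - T"] T summable_on_subset[OF that, of "triangles - T"]
    by (simp add: Un_absorb1)
  have "sum (comp_sq w) T \<le> (\<Sum>p\<in>T. \<delta>)"
    by (intro sum_mono less_imp_le) (simp add: comp_sq_def w_def sum_Q S)
  moreover have "infsum (comp_sq w) (triangles - T) = infsum (comp_sq u) (triangles - T)"
    by (intro infsum_cong) (simp add: comp_sq_def w_def sum_Q)
  moreover have "infsum (comp_sq u) (triangles - T) \<le> \<epsilon> / 4"
    using T(3) split[OF summ] by (simp add: normsq_SG_def dist_real_def)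
  ultimately have "normsq_SG w < \<epsilon>"
    using split[OF summ_w] \<delta> \<open>\<epsilon> > 0\<close> by (simp add: normsq_SG_def)
  with Q show ?thesis
    by (intro that[of Q "\<lambda>q. c (fst q) (snd q)"]) (simp_all add: w_def)
qed

lemma orthonormal_basis_basis_vec: "orthonormal_basis (basis_vec ` basis_index)"
  unfolding orthonormal_basis_def
proof (intro conjI ballI allI impI)
  show "basis_vec ` basis_index \<subseteq> H_SG" using basis_vec_H_SG by blast
  show "inner_SG e f = (if e = f then 1 else 0)"
    if "e \<in> basis_vec ` basis_index" "f \<in> basis_vec ` basis_index" for e f
    using that inj_on_basis_vec by (auto simp: inner_basis_vec_basis_vec inj_on_eq_iff)
  fix u :: vec and \<epsilon> :: real assume u: "u \<in> H_SG" and "\<epsilon> > 0"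
  then have "\<epsilon>\<^sup>2 > 0" by simp
  from trig_approx_H_SG[OF u this] obtain Q c where Q: "finite Q" "Q \<subseteq> basis_index"
    and err: "normsq_SG (\<lambda>p t. u p t - (\<Sum>q\<in>Q. c q * basis_vec q p t)) < \<epsilon>\<^sup>2" .
  have inj: "inj_on basis_vec Q" using inj_on_basis_vec Q(2) by (rule inj_on_subset)
  \<comment> \<open>In \<open>orthonormal_basis\<close> the coefficients are indexed by the vectors
    themselves, so c is transported along the inverse of \<open>basis_vec\<close>.\<close>
  define c' where "c' = c \<circ> the_inv_into Q basis_vec"
  have "(\<Sum>e\<in>basis_vec ` Q. c' e * e p t) = (\<Sum>q\<in>Q. c q * basis_vec q p t)" for p t
    by (subst sum.reindex[OF inj]) (auto simp: c'_def the_inv_into_f_f[OF inj] intro!: sum.cong)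
  then have "norm_SG (\<lambda>p t. u p t - (\<Sum>e\<in>basis_vec ` Q. c' e * e p t)) < \<epsilon>"
    using err \<open>\<epsilon> > 0\<close> by (simp add: norm_SG_eq real_less_lsqrt normsq_SG_nonneg)
  with Q show "\<exists>S c. finite S \<and> S \<subseteq> basis_vec ` basis_index \<and>
      norm_SG (\<lambda>p t. u p t - (\<Sum>e\<in>S. c e * e p t)) < \<epsilon>"
    by (intro exI[of _ "basis_vec ` Q"] exI[of _ c'] conjI) auto
qed

lemma parseval_basis_vec:
  assumes "u \<in> H_SG" "v \<in> H_SG"
  shows "((\<lambda>q. cnj (inner_SG (basis_vec q) u) * inner_SG (basis_vec q) v) has_sum inner_SG u v) basis_index"
  using parseval[OF orthonormal_basis_basis_vec assms]
  by (subst (asm) has_sum_reindex[OF inj_on_basis_vec]) (simp add: o_def)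

section \<open>Functions of the Dirac operator\<close>

lemma basis_vec_eigenvector: "(basis_vec q, \<lambda>p t. of_real (eigval q) * basis_vec q p t) \<in> dirac_SG"
proof -
  have "(basis_vec q p, \<lambda>t. of_real (eigval q) * basis_vec q p t) \<in> dirac_triangle (fst p)" for p
  proof (cases "p = fst q")
    case True
    then show ?thesis
      using dirac_triangle_fourier by (simp add: basis_vec_def eigval_def single_apply)
  next
    case False
    then show ?thesis by (simp add: basis_vec_def single_apply dirac_triangle_def L2_zero)
  qed
  then show ?thesis
    by (simp add: dirac_SG_def basis_vec_H_SG H_SG_scale case_prod_unfold)
qed

lemma eigenvector_coefficient:
  assumes "(e, \<lambda>p t. of_real c * e p t) \<in> dirac_SG" "q \<in> basis_index" "inner_SG (basis_vec q) e \<noteq> 0"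
  shows "c = eigval q"
proof -
  have "(e (fst q), \<lambda>t. of_real c * e (fst q) t) \<in> dirac_triangle (fst (fst q))"
    using assms(1,2) by (auto simp: dirac_SG_def basis_index_def)
  then have "of_real c * inner_SG (basis_vec q) e = of_real (eigval q) * inner_SG (basis_vec q) e"
    unfolding inner_basis_vec[OF assms(2)] dirac_triangle_def eigval_def
    by (simp add: L2_inner_scale_right)
  then show ?thesis using assms(3) by simp
qed

text \<open>Testing against the basis vectors already controls every eigenvector: by
  \<open>eigenvector_coefficient\<close>, an eigenvector for c has nonzero coefficients only at
  indices with eigenvalue c, so the factor h c can be pulled out of its Parseval sum.\<close>

lemma fun_calc_dirac_iff:
  "(u, v) \<in> fun_calc h dirac_SG \<longleftrightarrow> u \<in> H_SG \<and> v \<in> H_SG \<and>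
     (\<forall>q\<in>basis_index. inner_SG (basis_vec q) v = h (eigval q) * inner_SG (basis_vec q) u)"
proof
  assume "(u, v) \<in> fun_calc h dirac_SG"
  then show "u \<in> H_SG \<and> v \<in> H_SG \<and>
     (\<forall>q\<in>basis_index. inner_SG (basis_vec q) v = h (eigval q) * inner_SG (basis_vec q) u)"
    using basis_vec_eigenvector by (auto simp: fun_calc_def)
next
  assume *: "u \<in> H_SG \<and> v \<in> H_SG \<and>
     (\<forall>q\<in>basis_index. inner_SG (basis_vec q) v = h (eigval q) * inner_SG (basis_vec q) u)"
  have "inner_SG e v = h c * inner_SG e u" if e: "(e, \<lambda>p t. of_real c * e p t) \<in> dirac_SG" for e c
  proof -
    have e_H: "e \<in> H_SG" using e by (simp add: dirac_SG_def)
    have "((\<lambda>q. h c * (cnj (inner_SG (basis_vec q) e) * inner_SG (basis_vec q) u)) has_sum h c * inner_SG e u) basis_index"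
      using * e_H by (intro has_sum_cmult_right parseval_basis_vec) auto
    moreover have "h c * (cnj (inner_SG (basis_vec q) e) * inner_SG (basis_vec q) u) =
        cnj (inner_SG (basis_vec q) e) * inner_SG (basis_vec q) v" if "q \<in> basis_index" for q
      using eigenvector_coefficient[OF e that] * that by (cases "inner_SG (basis_vec q) e = 0") auto
    ultimately have "((\<lambda>q. cnj (inner_SG (basis_vec q) e) * inner_SG (basis_vec q) v) has_sum h c * inner_SG e u) basis_index"
      by (simp cong: has_sum_cong)
    then show ?thesis
      using parseval_basis_vec[OF e_H, of v] * has_sum_unique by blast
  qed
  with * show "(u, v) \<in> fun_calc h dirac_SG" by (simp add: fun_calc_def)
qed

section \<open>Domain and trace of functions of the Dirac operator\<close>

lemma norm_fourier: "cmod (fourier n k t) = 1"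
  by (simp add: fourier_def norm_exp_eq_Re)

lemma measure_arc_UNIV: "measure (arc_measure n) UNIV = 1"
  by (simp add: measure_def emeasure_arc_measure_UNIV)

text \<open>Produces an actual function with prescribed Fourier coefficients. Absolute summability
  makes the convergence uniform, so the limit is continuous, hence measurable and bounded, and
  integration commutes with the limit.\<close>

lemma fourier_series:
  fixes c :: "int \<Rightarrow> complex" and n :: nat
  assumes c: "(\<lambda>k. cmod (c k)) summable_on UNIV"
  defines "g \<equiv> \<lambda>t. \<Sum>\<^sub>\<infinity>k\<in>UNIV. c k * fourier n k t"
  shows "g \<in> L2 (arc_measure n)" "cmod (g t) \<le> (\<Sum>\<^sub>\<infinity>k\<in>UNIV. cmod (c k))"
    "L2_inner (arc_measure n) (fourier n l) g = c l"
proof -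
  have ulim: "uniform_limit UNIV (\<lambda>X t. \<Sum>k\<in>X. c k * fourier n k t) g (finite_subsets_at_top UNIV)"
    unfolding g_def by (rule Weierstrass_m_test_general[OF _ c]) (simp add: norm_mult norm_fourier)
  have "continuous_on UNIV g"
  proof (rule uniform_limit_theorem[OF _ ulim])
    show "\<forall>\<^sub>F X in finite_subsets_at_top UNIV. continuous_on UNIV (\<lambda>t. \<Sum>k\<in>X. c k * fourier n k t)"
      unfolding fourier_def by (intro always_eventually allI continuous_intros)
  qed simp
  then have meas: "g \<in> borel_measurable (arc_measure n)"
    by (simp add: borel_measurable_continuous_onI cong: measurable_cong_sets)
  show bnd: "cmod (g t) \<le> (\<Sum>\<^sub>\<infinity>k\<in>UNIV. cmod (c k))" for t
    using norm_infsum_bound[of "\<lambda>k. c k * fourier n k t" UNIV] c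
    by (simp add: g_def norm_mult norm_fourier)
  show L2: "g \<in> L2 (arc_measure n)"
    by (rule L2_bounded[OF finite_arc_measure meas bnd])
  have "cmod (L2_inner (arc_measure n) (fourier n l) g - c l) \<le> \<epsilon>" if "\<epsilon> > 0" for \<epsilon>
  proof -
    from uniform_limitD[OF ulim that] obtain X where X: "finite X"
      and close: "\<And>Y t. finite Y \<Longrightarrow> X \<subseteq> Y \<Longrightarrow> dist (\<Sum>k\<in>Y. c k * fourier n k t) (g t) < \<epsilon>"
      unfolding eventually_finite_subsets_at_top by auto
    \<comment> \<open>Inserting l guarantees that the partial sum has exactly c l as its coefficient
      at frequency l.\<close>
    define s where "s = (\<lambda>t. \<Sum>k\<in>insert l X. c k * fourier n k t)"
    have s_L2: "s \<in> L2 (arc_measure n)"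
      unfolding s_def by (intro L2_sum L2_scale fourier_in_L2)
    have sum: "L2_inner (arc_measure n) (fourier n l) (\<lambda>t. \<Sum>k\<in>Y. c k * fourier n k t) =
        (\<Sum>k\<in>Y. if k = l then c k else 0)" if "finite Y" for Y
      using that
    proof (induction Y)
      case (insert k Y)
      then show ?case
        by (simp add: L2_inner_add_right L2_inner_scale_right L2_sum L2_scale fourier_in_L2 fourier_orthonormal)
    qed simp
    have "L2_inner (arc_measure n) (fourier n l) (\<lambda>t. (g t - s t) + s t) =
        L2_inner (arc_measure n) (fourier n l) (\<lambda>t. g t - s t) + L2_inner (arc_measure n) (fourier n l) s"
      by (intro L2_inner_add_right fourier_in_L2 L2_diff L2 s_L2)
    moreover have "L2_inner (arc_measure n) (fourier n l) s = c l"
      unfolding s_def using sum[of "insert l X"] X by simp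
    ultimately have eq: "L2_inner (arc_measure n) (fourier n l) g - c l =
        L2_inner (arc_measure n) (fourier n l) (\<lambda>t. g t - s t)" by simp
    have "cmod (L2_inner (arc_measure n) (fourier n l) (\<lambda>t. g t - s t)) \<le>
        (\<integral>t. cmod (cnj (fourier n l t) * (g t - s t)) \<partial>arc_measure n)"
      unfolding L2_inner_def by (rule integral_norm_bound)
    also have "\<dots> \<le> (\<integral>t. \<epsilon> \<partial>arc_measure n)"
    proof (rule integral_mono)
      show "integrable (arc_measure n) (\<lambda>t. cmod (cnj (fourier n l t) * (g t - s t)))"
        by (intro integrable_norm L2_inner_integrable fourier_in_L2 L2_diff L2 s_L2)
      show "cmod (cnj (fourier n l t) * (g t - s t)) \<le> \<epsilon>" for t
        using close[of "insert l X" t] X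
        by (simp add: norm_mult norm_fourier s_def dist_norm norm_minus_commute subset_insertI less_imp_le)
    qed (rule integrable_arc_const)
    finally show ?thesis unfolding eq by (simp add: measure_arc_UNIV)
  qed
  then have "cmod (L2_inner (arc_measure n) (fourier n l) g - c l) \<le> 0"
    by (rule dense_ge)
  then show "L2_inner (arc_measure n) (fourier n l) g = c l" by simp
qed

text \<open>Bessel is applied to the component of u on one triangle only. A bound by that component,
  rather than by the norm of u, is what makes the image in \<open>Domain_fun_calc_dirac\<close>
  square summable over the triangles.\<close>

lemma inner_basis_vec_bound:
  assumes u: "u \<in> H_SG" and q: "q \<in> basis_index"
  shows "cmod (inner_SG (basis_vec q) u) \<le> sqrt (comp_sq u (fst q))"
proof -
  have p: "fst q \<in> triangles" using q by (auto simp: basis_index_def)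
  define w where "w = single (fst q) (u (fst q))"
  have "w \<in> H_SG" unfolding w_def by (intro single_H_SG H_SG_L2 u p)
  from bessel[OF orthonormal_basis_basis_vec this, of "{basis_vec q}"]
  have "(cmod (inner_SG (basis_vec q) w))\<^sup>2 \<le> normsq_SG w" using q by simp
  also have "normsq_SG w = comp_sq u (fst q)"
    unfolding w_def normsq_SG_single[OF p] comp_sq_def ..
  also have "inner_SG (basis_vec q) w = inner_SG (basis_vec q) u"
    by (simp add: inner_basis_vec[OF q] w_def single_apply)
  finally show ?thesis by (rule real_le_rsqrt)
qed

text \<open>The image of u is built on each triangle as the Fourier series with coefficients
  multiplied by h. The total C of the moduli of h bounds it uniformly by C times the norm of that
  component of u, with the same C for all triangles, so membership in \<open>H_SG\<close> is
  inherited from u.\<close>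

lemma Domain_fun_calc_dirac:
  assumes h: "(\<lambda>q. cmod (h (eigval q))) summable_on basis_index"
  shows "Domain (fun_calc h dirac_SG) = H_SG"
proof
  show "Domain (fun_calc h dirac_SG) \<subseteq> H_SG" by (auto simp: fun_calc_def)
  show "H_SG \<subseteq> Domain (fun_calc h dirac_SG)"
  proof
    fix u assume u: "u \<in> H_SG"
    define C where "C = (\<Sum>\<^sub>\<infinity>q\<in>basis_index. cmod (h (eigval q)))"
    define c where "c p k = h (eigval (p, k)) * inner_SG (basis_vec (p, k)) u" for p k
    define v where "v = (\<lambda>p t. \<Sum>\<^sub>\<infinity>k\<in>UNIV. c p k * fourier (fst p) k t)"
    have slice: "(\<lambda>k. cmod (h (eigval (p, k)))) summable_on UNIV"
        "(\<Sum>\<^sub>\<infinity>k\<in>UNIV. cmod (h (eigval (p, k)))) \<le> C" if "p \<in> triangles" for p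
    proof -
      have sub: "Pair p ` UNIV \<subseteq> basis_index" using that by (auto simp: basis_index_def)
      have inj: "inj_on (Pair p) UNIV" by (simp add: inj_on_def)
      have s: "(\<lambda>q. cmod (h (eigval q))) summable_on Pair p ` UNIV"
        by (rule summable_on_subset[OF h sub])
      then show "(\<lambda>k. cmod (h (eigval (p, k)))) summable_on UNIV"
        by (subst (asm) summable_on_reindex[OF inj]) (simp add: o_def)
      have "(\<Sum>\<^sub>\<infinity>k\<in>UNIV. cmod (h (eigval (p, k)))) = (\<Sum>\<^sub>\<infinity>q\<in>Pair p ` UNIV. cmod (h (eigval q)))"
        by (subst infsum_reindex[OF inj]) (simp add: o_def)
      also have "\<dots> \<le> C" unfolding C_def
        by (rule infsum_mono2[OF s h sub]) simp
      finally show "(\<Sum>\<^sub>\<infinity>k\<in>UNIV. cmod (h (eigval (p, k)))) \<le> C" .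
    qed
    have c_bnd: "cmod (c p k) \<le> cmod (h (eigval (p, k))) * sqrt (comp_sq u p)" if "p \<in> triangles" for p k
      unfolding c_def norm_mult
      using inner_basis_vec_bound[OF u, of "(p, k)"] that by (intro mult_left_mono) (auto simp: basis_index_def)
    have c: "(\<lambda>k. cmod (c p k)) summable_on UNIV" "(\<Sum>\<^sub>\<infinity>k\<in>UNIV. cmod (c p k)) \<le> C * sqrt (comp_sq u p)" if "p \<in> triangles" for p
    proof -
      have s: "(\<lambda>k. cmod (h (eigval (p, k))) * sqrt (comp_sq u p)) summable_on UNIV"
        by (intro summable_on_cmult_left slice that)
      show 1: "(\<lambda>k. cmod (c p k)) summable_on UNIV"
        by (rule summable_on_comparison_test[OF s]) (use c_bnd[OF that] in auto)
      have "(\<Sum>\<^sub>\<infinity>k\<in>UNIV. cmod (c p k)) \<le> (\<Sum>\<^sub>\<infinity>k\<in>UNIV. cmod (h (eigval (p, k))) * sqrt (comp_sq u p))"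
        by (rule infsum_mono[OF 1 s]) (rule c_bnd[OF that])
      also have "\<dots> \<le> C * sqrt (comp_sq u p)"
        using slice(2)[OF that] by (subst infsum_cmult_left') (auto intro!: mult_right_mono simp: comp_sq_nonneg)
      finally show "(\<Sum>\<^sub>\<infinity>k\<in>UNIV. cmod (c p k)) \<le> C * sqrt (comp_sq u p)" .
    qed
    have v_L2: "v p \<in> L2 (arc_measure (fst p))" if "p \<in> triangles" for p
      unfolding v_def by (rule fourier_series(1)[OF c(1)[OF that]])
    have "v \<in> H_SG"
      unfolding H_SG_iff
    proof (intro conjI ballI v_L2)
      show "comp_sq v summable_on triangles"
      proof (rule summable_on_comparison_test)
        show "(\<lambda>p. C\<^sup>2 * comp_sq u p) summable_on triangles"
          using u by (intro summable_on_cmult_right) (auto simp: H_SG_iff)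
        show "comp_sq v p \<le> C\<^sup>2 * comp_sq u p" if "p \<in> triangles" for p
        proof -
          have "cmod (v p t) \<le> C * sqrt (comp_sq u p)" for t
            using order_trans[OF fourier_series(2)[OF c(1)[OF that]] c(2)[OF that]] by (simp add: v_def)
          then have "(cmod (v p t))\<^sup>2 \<le> (C * sqrt (comp_sq u p))\<^sup>2" for t
            by (intro power_mono) auto
          then have "comp_sq v p \<le> (\<integral>t. (C * sqrt (comp_sq u p))\<^sup>2 \<partial>arc_measure (fst p))"
            unfolding comp_sq_def
            by (intro integral_mono L2_sq_integrable v_L2 that integrable_arc_const)
          then show ?thesis
            by (simp add: measure_arc_UNIV power_mult_distrib comp_sq_nonneg)
        qed
      qed (rule comp_sq_nonneg)
    qed
    moreover have "inner_SG (basis_vec q) v = h (eigval q) * inner_SG (basis_vec q) u" if q: "q \<in> basis_index" for q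
    proof -
      have "fst q \<in> triangles" using q by (auto simp: basis_index_def)
      from fourier_series(3)[OF c(1)[OF this], of "fst (fst q)" "snd q"] show ?thesis
        by (simp add: inner_basis_vec[OF q] v_def) (simp add: c_def inner_basis_vec[OF q])
    qed
    ultimately have "(u, v) \<in> fun_calc h dirac_SG" using u by (simp add: fun_calc_dirac_iff)
    then show "u \<in> Domain (fun_calc h dirac_SG)" by blast
  qed
qed

lemma has_trace_fun_calc_dirac:
  assumes h: "(\<lambda>q. cmod (h (eigval q))) summable_on basis_index"
    and x: "((\<lambda>q. h (eigval q)) has_sum x) basis_index"
  shows "has_trace (fun_calc h dirac_SG) x"
  unfolding has_trace_def
proof (intro conjI allI impI Domain_fun_calc_dirac h)
  fix B and Te :: "vec \<Rightarrow> vec"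
  assume B: "orthonormal_basis B" and Te: "\<forall>e\<in>B. (e, Te e) \<in> fun_calc h dirac_SG"
  \<comment> \<open>Summed over B, f q gives h (eigval q) by Parseval for B; summed over q it gives
    the diagonal entry of the operator at e by Parseval for the eigenbasis. The rows of moduli sum
    to cmod (h (eigval q)), which justifies the exchange.\<close>
  define f where "f q e = h (eigval q) * of_real ((cmod (inner_SG (basis_vec q) e))\<^sup>2)" for q e
  have row: "((\<lambda>e. (cmod (inner_SG (basis_vec q) e))\<^sup>2) has_sum 1) B" if "q \<in> basis_index" for q
  proof -
    have "complex_of_real (normsq_SG (basis_vec q)) = 1"
      using inner_basis_vec_basis_vec[OF that that] by (simp add: inner_SG_self)
    then have "normsq_SG (basis_vec q) = 1" by (simp only: of_real_eq_1_iff)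
    moreover have "cmod (inner_SG e (basis_vec q)) = cmod (inner_SG (basis_vec q) e)" for e
      by (metis complex_mod_cnj inner_SG_cnj)
    ultimately show ?thesis using parseval_norm[OF B basis_vec_H_SG[of q]] by simp
  qed
  have "(\<lambda>x. cmod (case x of (q, e) \<Rightarrow> f q e)) summable_on basis_index \<times> B"
    unfolding Infinite_Sum.abs_summable_on_Sigma_iff
  proof (intro conjI ballI)
    fix q assume q: "q \<in> basis_index"
    have "((\<lambda>e. cmod (h (eigval q)) * (cmod (inner_SG (basis_vec q) e))\<^sup>2) has_sum cmod (h (eigval q)) * 1) B"
      by (intro has_sum_cmult_right row q)
    then show "(\<lambda>e. cmod (case (q, e) of (q, e) \<Rightarrow> f q e)) summable_on B"
      by (auto simp: f_def norm_mult norm_power dest: has_sum_imp_summable)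
  next
    have "(\<Sum>\<^sub>\<infinity>e\<in>B. cmod (f q e)) = cmod (h (eigval q))" if "q \<in> basis_index" for q
      using infsumI[OF has_sum_cmult_right[OF row[OF that], of "cmod (h (eigval q))"]]
      by (simp add: f_def norm_mult norm_power)
    then show "(\<lambda>q. norm (\<Sum>\<^sub>\<infinity>e\<in>B. cmod (case (q, e) of (q, e) \<Rightarrow> f q e))) summable_on basis_index"
      using h by (simp cong: summable_on_cong)
  qed
  then have "(\<lambda>(q, e). f q e) summable_on basis_index \<times> B"
    by (rule abs_summable_summable)
  moreover have "(f q has_sum h (eigval q)) B" if "q \<in> basis_index" for q
    using has_sum_cmult_right[OF has_sum_of_real[OF row[OF that]], of "h (eigval q)"] by (simp add: f_def[abs_def])
  ultimately have "((\<lambda>(q, e). f q e) has_sum x) (basis_index \<times> B)"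
    by (intro has_sum_SigmaI[OF _ x]) auto
  then have "((\<lambda>(e, q). f q e) has_sum x) (B \<times> basis_index)"
    by (subst (asm) has_sum_swap) (simp add: case_prod_unfold)
  then show "((\<lambda>e. inner_SG e (Te e)) has_sum x) B"
  proof (rule has_sum_SigmaD)
    fix e assume "e \<in> B"
    with Te have e: "e \<in> H_SG" "Te e \<in> H_SG"
      "\<And>q. q \<in> basis_index \<Longrightarrow> inner_SG (basis_vec q) (Te e) = h (eigval q) * inner_SG (basis_vec q) e"
      by (auto simp: fun_calc_dirac_iff)
    have "cnj (inner_SG (basis_vec q) e) * inner_SG (basis_vec q) (Te e) = f q e" if "q \<in> basis_index" for q
      unfolding f_def e(3)[OF that] complex_norm_square by (simp add: mult_ac)
    with parseval_basis_vec[OF e(1,2)]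
    show "((\<lambda>q. case (e, q) of (e, q) \<Rightarrow> f q e) has_sum inner_SG e (Te e)) basis_index"
      by (simp cong: has_sum_cong)
  qed
qed

lemma has_traceD:
  assumes "has_trace T x" "orthonormal_basis B" "\<And>e. e \<in> B \<Longrightarrow> (e, Te e) \<in> T"
  shows "((\<lambda>e. inner_SG e (Te e)) has_sum x) B"
  using assms by (simp add: has_trace_def)

text \<open>If there were no orthonormal basis, or no representatives \<open>Te\<close>, the
  condition on sums would hold vacuously for every value. The eigenbasis and the full domain exclude
  this.\<close>

lemma has_trace_unique:
  assumes "has_trace T x" "has_trace T y"
  shows "x = y"
proof -
  have "\<exists>v. (e, v) \<in> T" if "e \<in> basis_vec ` basis_index" for e
    using assms(1) basis_vec_H_SG that by (auto simp: has_trace_def)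
  then obtain Te where Te: "\<And>e. e \<in> basis_vec ` basis_index \<Longrightarrow> (e, Te e) \<in> T" by metis
  show ?thesis
    using has_traceD[OF assms(1) orthonormal_basis_basis_vec Te]
      has_traceD[OF assms(2) orthonormal_basis_basis_vec Te] by (rule has_sum_unique)
qed

lemma tr_eqI: "has_trace T x \<Longrightarrow> tr T = x"
  unfolding tr_def using has_trace_unique by blast

section \<open>The trace\<close>

text \<open>The reflection k -> - k - 1 preserves \<bar>k + 1/2\<bar> and exchanges negative and
  nonnegative integers. The doubling is the origin of the + 1 in 2 powr (z + 1). The value type is
  general because the lemma is applied to real moduli and to complex terms.\<close>

lemma has_sum_abs_half_integers:
  fixes g :: "real \<Rightarrow> 'a :: topological_comm_monoid_add"
  assumes "((\<lambda>m. g (real m + 1 / 2)) has_sum x) UNIV"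
  shows "((\<lambda>k. g \<bar>of_int k + 1 / 2\<bar>) has_sum (x + x)) (UNIV :: int set)"
proof -
  have 1: "((\<lambda>k. g \<bar>of_int k + 1 / 2\<bar>) has_sum x) (range int)"
    using assms by (subst has_sum_reindex) (simp_all add: o_def)
  have "((\<lambda>k. g \<bar>of_int k + 1 / 2\<bar>) \<circ> (\<lambda>m. - int m - 1)) m = g (real m + 1 / 2)" for m
    by (simp add: abs_if algebra_simps)
  then have 2: "((\<lambda>k. g \<bar>of_int k + 1 / 2\<bar>) has_sum x) (range (\<lambda>m. - int m - 1))"
    using assms by (subst has_sum_reindex) (simp_all add: inj_on_def cong: has_sum_cong)
  have "range int \<inter> range (\<lambda>m. - int m - 1) = {}" by auto
  from has_sum_Un_disjoint[OF 1 2 this]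
  have "((\<lambda>k. g \<bar>of_int k + 1 / 2\<bar>) has_sum (x + x)) (range int \<union> range (\<lambda>m. - int m - 1))" .
  moreover have "k \<in> range int \<union> range (\<lambda>m. - int m - 1)" for k
  proof (cases "k \<ge> 0")
    case True
    then have "k = int (nat k)" by simp
    then show ?thesis by blast
  next
    case False
    then have "k = - int (nat (- k - 1)) - 1" by simp
    then show ?thesis by blast
  qed
  then have "range int \<union> range (\<lambda>m. - int m - 1) = UNIV" by blast
  ultimately show ?thesis by simp
qed

lemma summable_on_basis_index:
  fixes a :: "nat \<Rightarrow> real" and b :: "int \<Rightarrow> real"
  assumes a: "(\<lambda>n. 3 ^ n * a n) summable_on UNIV" "\<And>n. a n \<ge> 0"
    and b: "(b has_sum \<beta>) UNIV" "\<And>k. b k \<ge> 0"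
  shows "(\<lambda>q. a (fst (fst q)) * b (snd q)) summable_on basis_index"
  unfolding basis_index_def
proof (rule summable_on_SigmaI)
  show "((\<lambda>k. a (fst (fst (p, k))) * b (snd (p, k))) has_sum a (fst p) * \<beta>) UNIV" for p :: "nat \<times> nat"
    using has_sum_cmult_right[OF b(1), of "a (fst p)"] by simp
  have \<beta>: "\<beta> \<ge> 0" using has_sum_nonneg[OF b(1)] b(2) by simp
  show "(\<lambda>p. a (fst p) * \<beta>) summable_on triangles"
    unfolding triangles_def
  proof (rule summable_on_SigmaI)
    show "((\<lambda>i. a (fst (n, i)) * \<beta>) has_sum (3 ^ n * a n * \<beta>)) {1..3 ^ n :: nat}" for n
      by (rule has_sum_finiteI) simp_all
    show "(\<lambda>n. 3 ^ n * a n * \<beta>) summable_on UNIV"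
      by (intro summable_on_cmult_left a)
  qed (use a \<beta> in simp)
qed (use a b in simp)

text \<open>Once the whole family is known to be summable, its value can be computed by iterated
  sums: over the frequencies, over the 3^n triangles of a level, over the levels.\<close>

lemma has_sum_basis_index:
  fixes a :: "nat \<Rightarrow> complex" and b :: "int \<Rightarrow> complex"
  assumes a: "((\<lambda>n. 3 ^ n * a n) has_sum \<alpha>) UNIV" and b: "(b has_sum \<beta>) UNIV"
    and summ: "(\<lambda>q. a (fst (fst q)) * b (snd q)) summable_on basis_index"
  shows "((\<lambda>q. a (fst (fst q)) * b (snd q)) has_sum \<alpha> * \<beta>) basis_index"
proof -
  obtain s where s: "((\<lambda>q. a (fst (fst q)) * b (snd q)) has_sum s) basis_index"
    using summ by (auto simp: summable_on_def)
  then have "((\<lambda>p. a (fst p) * \<beta>) has_sum s) triangles"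
    unfolding basis_index_def
  proof (rule has_sum_SigmaD)
    show "((\<lambda>k. a (fst (fst (p, k))) * b (snd (p, k))) has_sum a (fst p) * \<beta>) UNIV" for p :: "nat \<times> nat"
      using has_sum_cmult_right[OF b, of "a (fst p)"] by simp
  qed
  then have "((\<lambda>n. 3 ^ n * a n * \<beta>) has_sum s) UNIV"
    unfolding triangles_def
  proof (rule has_sum_SigmaD)
    show "((\<lambda>i. a (fst (n, i)) * \<beta>) has_sum (3 ^ n * a n * \<beta>)) {1..3 ^ n :: nat}" for n
      by (rule has_sum_finiteI) simp_all
  qed
  moreover have "((\<lambda>n. 3 ^ n * a n * \<beta>) has_sum \<alpha> * \<beta>) UNIV"
    by (rule has_sum_cmult_left[OF a])
  ultimately have "s = \<alpha> * \<beta>" by (rule has_sum_unique)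
  with s show ?thesis by simp
qed

lemma norm_of_real_powr: "x \<ge> 0 \<Longrightarrow> cmod (of_real x powr w) = x powr Re w"
  by (subst norm_powr_real_powr) auto

lemma of_real_mult_powr:
  assumes "x \<ge> 0" "y \<ge> 0"
  shows "complex_of_real (x * y) powr w = of_real x powr w * of_real y powr w"
  unfolding of_real_mult by (rule powr_times_real) (use assms in simp_all)

lemma of_real_power_powr:
  assumes "x > 0"
  shows "complex_of_real (x ^ n) powr w = (of_real x powr w) ^ n"
proof (induction n)
  case (Suc n)
  then show ?case using of_real_mult_powr[of x "x ^ n" w] assms by (simp del: of_real_mult of_real_power)
qed simp

lemma summable_half_integer_powr:
  assumes "\<sigma> > 1"
  shows "summable (\<lambda>m. (real m + 1 / 2) powr (- \<sigma>))"
proof (rule summable_comparison_test'[where N = 0])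
  show "summable (\<lambda>m. 2 powr \<sigma> * real (Suc m) powr (- \<sigma>))"
    by (intro summable_mult summable_Suc_powr) (use assms in simp)
  show "norm ((real m + 1 / 2) powr (- \<sigma>)) \<le> 2 powr \<sigma> * real (Suc m) powr (- \<sigma>)" for m
  proof -
    have "(real m + 1 / 2) powr (- \<sigma>) \<le> (real (Suc m) / 2) powr (- \<sigma>)"
      by (rule powr_mono2') (use assms in auto)
    also have "\<dots> = 2 powr \<sigma> * real (Suc m) powr (- \<sigma>)"
      by (simp add: powr_divide powr_minus field_simps)
    finally show ?thesis by simp
  qed
qed

lemma half_integer_powr_sums:
  assumes "Re z > 1"
  shows "(\<lambda>m. complex_of_real (real m + 1 / 2) powr (- z)) sums
    (2 powr z * ((1 - 2 powr (- z)) * (\<Sum>n. 1 / of_nat (Suc n) powr z)))"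
proof -
  have "complex_of_real (real m + 1 / 2) powr (- z) = 2 powr z * of_nat (2 * m + 1) powr (- z)" for m
  proof -
    have "complex_of_real (2 * (real m + 1 / 2)) powr (- z) = 2 powr (- z) * complex_of_real (real m + 1 / 2) powr (- z)"
      using of_real_mult_powr[of 2 "real m + 1 / 2" "- z"] by simp
    moreover have "complex_of_real (2 * (real m + 1 / 2)) = of_nat (2 * m + 1)" by simp
    moreover have "2 powr z * 2 powr (- z) = 1"
      by (simp flip: powr_add)
    ultimately show ?thesis by (metis mult.assoc mult.left_neutral)
  qed
  then show ?thesis using sums_mult[OF odd_dirichlet_sums[OF assms]] by simp
qed

lemma eigval_powr_has_sum:
  assumes z: "Re z > ln 3 / ln 2"
  shows "(\<lambda>q. cmod (of_real \<bar>eigval q\<bar> powr (- z))) summable_on basis_index" (is ?A)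
    and "((\<lambda>q. of_real \<bar>eigval q\<bar> powr (- z)) has_sum
      2 powr (z + 1) * ((1 - 2 powr (- z)) / (1 - 3 * 2 powr (- z))) * (\<Sum>n. 1 / of_nat (Suc n) powr z)) basis_index"
proof -
  have z1: "Re z > 1" using z log_2_3_gt by linarith
  define a where "a n = complex_of_real (2 ^ n) powr (- z)" for n :: nat
  define b where "b k = complex_of_real \<bar>of_int k + 1 / 2\<bar> powr (- z)" for k :: int
  have eig: "complex_of_real \<bar>eigval q\<bar> powr (- z) = a (fst (fst q)) * b (snd q)" for q
  proof -
    have "\<bar>eigval q\<bar> = 2 ^ fst (fst q) * \<bar>of_int (snd q) + 1 / 2\<bar>"
      by (simp add: eigval_def dirac_eigenvalue_def abs_mult)
    then show ?thesis unfolding a_def b_def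
      by (simp only: of_real_mult_powr abs_ge_zero zero_le_power zero_le_numeral)
  qed
  have norm_b: "cmod (b k) = \<bar>of_int k + 1 / 2\<bar> powr (- Re z)" for k
    unfolding b_def by (subst norm_of_real_powr) auto
  have geom: "3 ^ n * a n = (3 * 2 powr (- z)) ^ n" for n
    using of_real_power_powr[of 2 n "- z"] by (simp add: a_def power_mult_distrib)
  \<comment> \<open>This is where the abscissa log 3 / log 2 comes from: it is the threshold for
    convergence of the geometric series over the levels, while the sum over half integers converges
    already for Re z > 1.\<close>
  have "3 < 2 powr Re z"
  proof -
    have "ln 3 < Re z * ln 2" using z by (simp add: field_simps)
    then have "exp (ln 3) < exp (Re z * ln 2)" by (subst exp_less_cancel_iff)
    then show ?thesis by (simp add: powr_def)
  qed
  moreover have "cmod (2 powr (- z)) = 2 powr (- Re z)"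
    using norm_of_real_powr[of 2 "- z"] by simp
  ultimately have small: "cmod (3 * 2 powr (- z)) < 1"
    unfolding norm_mult by (simp only: norm_numeral powr_minus) (simp add: field_simps)
  have sa: "summable (\<lambda>n. cmod (3 ^ n * a n))"
    unfolding geom norm_power using small by (intro summable_geometric) simp
  have sb: "((\<lambda>m. (real m + 1 / 2) powr (- Re z)) has_sum (\<Sum>m. (real m + 1 / 2) powr (- Re z))) UNIV"
    by (intro sums_nonneg_imp_has_sum summable_sums summable_half_integer_powr z1) simp
  have "(\<lambda>q. cmod (a (fst (fst q))) * cmod (b (snd q))) summable_on basis_index"
    unfolding norm_b
  proof (rule summable_on_basis_index)
    show "(\<lambda>n. 3 ^ n * cmod (a n)) summable_on UNIV"
      using summable_nonneg_imp_summable_on[OF sa] by (simp add: norm_mult norm_power)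
    show "((\<lambda>k. \<bar>of_int k + 1 / 2\<bar> powr (- Re z)) has_sum
        (\<Sum>m. (real m + 1 / 2) powr (- Re z)) + (\<Sum>m. (real m + 1 / 2) powr (- Re z))) UNIV"
      by (rule has_sum_abs_half_integers[OF sb])
  qed simp_all
  then show A: ?A unfolding eig norm_mult .
  define D where "D = (\<Sum>n. 1 / of_nat (Suc n) powr z)"
  have "((\<lambda>q. a (fst (fst q)) * b (snd q)) has_sum
      (1 / (1 - 3 * 2 powr (- z))) * (2 powr z * ((1 - 2 powr (- z)) * D) + 2 powr z * ((1 - 2 powr (- z)) * D))) basis_index"
  proof (rule has_sum_basis_index)
    show "((\<lambda>n. 3 ^ n * a n) has_sum 1 / (1 - 3 * 2 powr (- z))) UNIV"
      using geometric_sums[OF small] by (intro norm_summable_imp_has_sum sa) (simp add: geom)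
    have "((\<lambda>m. complex_of_real (real m + 1 / 2) powr (- z)) has_sum 2 powr z * ((1 - 2 powr (- z)) * D)) UNIV"
    proof (rule norm_summable_imp_has_sum)
      show "summable (\<lambda>m. cmod (complex_of_real (real m + 1 / 2) powr (- z)))"
        by (subst norm_of_real_powr) (simp_all add: summable_half_integer_powr[OF z1])
      show "(\<lambda>m. complex_of_real (real m + 1 / 2) powr (- z)) sums (2 powr z * ((1 - 2 powr (- z)) * D))"
        unfolding D_def by (rule half_integer_powr_sums[OF z1])
    qed
    from has_sum_abs_half_integers[OF this]
    show "(b has_sum 2 powr z * ((1 - 2 powr (- z)) * D) + 2 powr z * ((1 - 2 powr (- z)) * D)) UNIV"
      unfolding b_def .
    show "(\<lambda>q. a (fst (fst q)) * b (snd q)) summable_on basis_index"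
      using abs_summable_summable[OF A] unfolding eig .
  qed
  moreover have "(1 / (1 - 3 * 2 powr (- z))) * (2 powr z * ((1 - 2 powr (- z)) * D) + 2 powr z * ((1 - 2 powr (- z)) * D)) =
      2 powr (z + 1) * ((1 - 2 powr (- z)) / (1 - 3 * 2 powr (- z))) * D"
    by (simp add: powr_add)
  ultimately show "((\<lambda>q. of_real \<bar>eigval q\<bar> powr (- z)) has_sum
      2 powr (z + 1) * ((1 - 2 powr (- z)) / (1 - 3 * 2 powr (- z))) * (\<Sum>n. 1 / of_nat (Suc n) powr z)) basis_index"
    unfolding eig D_def by (simp only:)
qed

lemma has_trace_abs_dirac_powr:
  assumes "Re z > ln 3 / ln 2"
  shows "has_trace (abs_cpow dirac_SG (- z))
    (2 powr (z + 1) * ((1 - 2 powr (- z)) / (1 - 3 * 2 powr (- z))) * riemann_zeta z)"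
proof -
  have "Re z > 1" using assms log_2_3_gt by linarith
  then have "riemann_zeta z = (\<Sum>n. 1 / of_nat (Suc n) powr z)"
    using riemann_zeta_eq by metis
  then show ?thesis
    unfolding abs_cpow_def using eigval_powr_has_sum[OF assms]
    by (intro has_trace_fun_calc_dirac) simp_all
qed

theorem mainTheorem3:
  shows "\<exists>F. F nicely_meromorphic_on UNIV \<and>
    (\<forall>z. Re z > ln 3 / ln 2 \<longrightarrow>
       has_trace (abs_cpow dirac_SG (- z)) (zeta_SG z) \<and> F z = zeta_SG z) \<and>
    (\<forall>z. \<not> is_pole F z \<longrightarrow>
       F z = 2 powr (z + 1) * ((1 - 2 powr (- z)) / (1 - 3 * 2 powr (- z))) * riemann_zeta z) \<and>
    {z. is_pole F z} =
      {1} \<union> {of_real (ln 3 / ln 2) + \<i> * of_int k * of_real (2 * pi / ln 2) | k. True}"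
proof -
  \<comment> \<open>The closed formula itself serves as the continuation; at its poles it takes the
    value 0 by division by zero and the convention for \<open>riemann_zeta\<close> at 1.\<close>
  let ?F = "\<lambda>z. 2 powr (z + 1) * ((1 - 2 powr (- z)) / (1 - 3 * 2 powr (- z))) * riemann_zeta z"
  have "has_trace (abs_cpow dirac_SG (- z)) (zeta_SG z) \<and> ?F z = zeta_SG z" if "Re z > ln 3 / ln 2" for z
    using has_trace_abs_dirac_powr[OF that] tr_eqI[OF has_trace_abs_dirac_powr[OF that]]
    by (simp add: zeta_SG_def)
  then show ?thesis
    using zeta_SG_formula_meromorphic by (intro exI[of _ ?F]) blast
qed

end
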